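(* Let $n\ge 2$, $1\le\ell\le n$, and let $G_1,\ldots,G_n$ be finite connected vertex-transitive graphs with \[\tfrac12\geq\frac{\alpha(G_1)}{|V(G_1)|}=\cdots=\frac{\alpha(G_\ell)}{|V(G_\ell)|}>\frac{\alpha(G_{\ell+1})}{|V(G_{\ell+1})|}\geq\cdots\geq\frac{\alpha(G_n)}{|V(G_n)|}.\] Then $G_1\times G_2\times\cdots\times G_n$ is MIS-normal if and only if one of the following holds: (i) $\frac{\alpha(G_1)}{|V(G_1)|}<\frac12$ and, whenever $\ell>1$, the graphs $G_1,\ldots,G_\ell$ are all IS-primitive; (ii) $\frac{\alpha(G_1)}{|V(G_1)|}=\frac12$ and $\ell\le 2$.
   Context: All graphs are finite and simple; $\alpha(\cdot)$ is the independence number. The direct product $G\times H$ has vertex set $V(G)\times V(H)$, with $(u_1,v_1)\sim(u_2,v_2)$ iff $u_1u_2\in E(G)$ and $v_1v_2\in E(H)$. A product $G_1\times\cdots\times G_n$ is MIS-normal if every maximum independent set of it is the preimage, under the projection onto some factor $G_i$, of an independent set of $G_i$. For $A\subseteq V(G)$, $N_G(A)=\{b: ab\in E(G)\text{ for some }a\in A\}$, $N_G[A]=N_G(A)\cup A$. A (nonempty) independent set $A$ of $G$ is imprimitive if $|A|<\alpha(G)$ and $\frac{|A|}{|N_G[A]|}=\frac{\alpha(G)}{|V(G)|}$; $G$ is IS-imprimitive if it has an imprimitive independent set and IS-primitive otherwise. *)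

theory Defs
  imports Complex_Main "HOL-Library.FuncSet"
begin

record 'a sgraph =
  verts :: "'a set"
  adj :: "'a \<Rightarrow> 'a \<Rightarrow> bool"

definition simple_graph :: "('a, 'b) sgraph_scheme \<Rightarrow> bool" where
  "simple_graph G \<longleftrightarrow> finite (verts G)
     \<and> (\<forall>u v. adj G u v \<longrightarrow> u \<in> verts G \<and> v \<in> verts G)
     \<and> (\<forall>u v. adj G u v \<longrightarrow> adj G v u)
     \<and> (\<forall>v. \<not> adj G v v)"

definition connected_graph :: "('a, 'b) sgraph_scheme \<Rightarrow> bool" where
  "connected_graph G \<longleftrightarrow> verts G \<noteq> {}
     \<and> (\<forall>u\<in>verts G. \<forall>v\<in>verts G. (adj G)\<^sup>*\<^sup>* u v)"

definition graph_automorphism :: "('a, 'b) sgraph_scheme \<Rightarrow> ('a \<Rightarrow> 'a) \<Rightarrow> bool" where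
  "graph_automorphism G f \<longleftrightarrow> bij_betw f (verts G) (verts G)
     \<and> (\<forall>u\<in>verts G. \<forall>v\<in>verts G. adj G u v \<longleftrightarrow> adj G (f u) (f v))"

definition vertex_transitive :: "('a, 'b) sgraph_scheme \<Rightarrow> bool" where
  "vertex_transitive G \<longleftrightarrow>
     (\<forall>u\<in>verts G. \<forall>v\<in>verts G. \<exists>f. graph_automorphism G f \<and> f u = v)"

definition independent :: "('a, 'b) sgraph_scheme \<Rightarrow> 'a set \<Rightarrow> bool" where
  "independent G A \<longleftrightarrow> A \<subseteq> verts G \<and> (\<forall>u\<in>A. \<forall>v\<in>A. \<not> adj G u v)"

definition alpha :: "('a, 'b) sgraph_scheme \<Rightarrow> nat" where
  "alpha G = Max (card ` {A. independent G A})"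

definition max_independent :: "('a, 'b) sgraph_scheme \<Rightarrow> 'a set \<Rightarrow> bool" where
  "max_independent G A \<longleftrightarrow> independent G A \<and> card A = alpha G"

definition ind_ratio :: "('a, 'b) sgraph_scheme \<Rightarrow> real" where
  "ind_ratio G = real (alpha G) / real (card (verts G))"

definition nbhd :: "('a, 'b) sgraph_scheme \<Rightarrow> 'a set \<Rightarrow> 'a set" where
  "nbhd G A = {b. \<exists>a\<in>A. adj G a b}"

definition closed_nbhd :: "('a, 'b) sgraph_scheme \<Rightarrow> 'a set \<Rightarrow> 'a set" where
  "closed_nbhd G A = nbhd G A \<union> A"

definition imprimitive :: "('a, 'b) sgraph_scheme \<Rightarrow> 'a set \<Rightarrow> bool" where
  "imprimitive G A \<longleftrightarrow> independent G A \<and> A \<noteq> {} \<and> card A < alpha G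
     \<and> real (card A) / real (card (closed_nbhd G A)) = ind_ratio G"

definition IS_primitive :: "('a, 'b) sgraph_scheme \<Rightarrow> bool" where
  "IS_primitive G \<longleftrightarrow> \<not> (\<exists>A. imprimitive G A)"

definition direct_prod :: "nat set \<Rightarrow> (nat \<Rightarrow> 'a sgraph) \<Rightarrow> (nat \<Rightarrow> 'a) sgraph" where
  "direct_prod I Gs = \<lparr> verts = PiE I (\<lambda>i. verts (Gs i)),
     adj = (\<lambda>x y. x \<in> PiE I (\<lambda>i. verts (Gs i)) \<and> y \<in> PiE I (\<lambda>i. verts (Gs i))
                 \<and> (\<forall>i\<in>I. adj (Gs i) (x i) (y i))) \<rparr>"

definition MIS_normal :: "nat set \<Rightarrow> (nat \<Rightarrow> 'a sgraph) \<Rightarrow> bool" where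
  "MIS_normal I Gs \<longleftrightarrow>
     (\<forall>S. max_independent (direct_prod I Gs) S \<longrightarrow>
        (\<exists>i\<in>I. \<exists>A. independent (Gs i) A \<and>
            S = {x \<in> verts (direct_prod I Gs). x i \<in> A}))"

end

(*
  Let S be independent in G x H, with fibres S_u = {v. (u,v) in S}. Split S into the points (u,v) for
  which v is isolated in the graph induced on S_u, with fibres isol u (independent in H), and the
  others, with fibres act v over H (independent in G). The sets P = {(u,v). v in N[isol u]} and
  Q = {(u,v). u in N[act v]} are disjoint, so the inequality |A| <= r |N[A]| for independent sets
  A of a vertex-transitive graph of ratio r bounds |S| by the larger ratio times |G||H|. In the case
  of equality P and Q cover everything and all isol u, act v are tight in that inequality; if
  H has the smaller ratio or both graphs are primitive, connectedness makes the fibres constant.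
  Products of primitive graphs of equal ratio below 1/2 are primitive and connected, which allows
  an induction on the number of factors.

  Conversely, an imprimitive A in one factor p and a maximum independent T in another factor q of
  maximal ratio give the maximum independent set {x_p in A} Un {x_p notin N[A], x_q in T}, and
  three bipartite factors give a majority set; neither depends on a single coordinate.
*)

theory Submission
  imports Defs
begin

text \<open>The inequality |A| <= r |N[A]| comes from averaging: by vertex-transitivity every vertex
  lies in equally many maximum independent sets, so one of them meets the complement of N[A] in at
  least the share r, and that part can be added to A.

  The induction multiplies a product already treated with one more factor, so that product must
  itself be primitive and connected. Connectedness is the obstacle: a product of two bipartite
  graphs can be disconnected. Below ratio 1/2 the induction therefore carries connectedness by even
  walks, which products inherit when every vertex has a neighbour. At ratio 1/2 at most two factors
  have the largest ratio, and a connected vertex-transitive graph of ratio 1/2 is always primitive.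
  Factors of smaller ratio are appended last; there connectedness of the new factor is enough.

  Primitivity of a product is derived from its normality: an imprimitive set extends to a maximum
  independent one, which is a cylinder over a factor, and an expansion count excludes nonempty
  proper tight subsets of a cylinder.\<close>

lemma finite_independent_sets:
  assumes "simple_graph G"
  shows "finite {A. independent G A}"
proof (rule finite_subset)
  show "{A. independent G A} \<subseteq> Pow (verts G)"
    by (auto simp: independent_def)
  show "finite (Pow (verts G))"
    using assms by (simp add: simple_graph_def)
qed

lemma card_le_alpha:
  assumes "simple_graph G" "independent G A"
  shows "card A \<le> alpha G"
  unfolding alpha_def
  by (rule Max_ge) (use assms finite_independent_sets in auto)

lemma ex_max_independent:
  assumes "simple_graph G"
  shows "\<exists>A. max_independent G A"
proof -
  have "independent G {}"
    by (simp add: independent_def)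
  then have "Max (card ` {A. independent G A}) \<in> card ` {A. independent G A}"
    using finite_independent_sets[OF assms] by (intro Max_in) auto
  then show ?thesis
    by (auto simp: max_independent_def alpha_def)
qed

lemma independent_subset: "independent G B \<Longrightarrow> A \<subseteq> B \<Longrightarrow> independent G A"
  unfolding independent_def by blast

lemma independent_finite: "simple_graph G \<Longrightarrow> independent G A \<Longrightarrow> finite A"
  unfolding independent_def simple_graph_def using finite_subset by blast

lemma adj_verts: "simple_graph G \<Longrightarrow> adj G u v \<Longrightarrow> u \<in> verts G \<and> v \<in> verts G"
  unfolding simple_graph_def by blast

lemma adj_sym: "simple_graph G \<Longrightarrow> adj G u v \<Longrightarrow> adj G v u"
  unfolding simple_graph_def by blast

lemma nbhd_subset: "simple_graph G \<Longrightarrow> nbhd G A \<subseteq> verts G"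
  unfolding nbhd_def simple_graph_def by blast

lemma closed_nbhd_subset: "simple_graph G \<Longrightarrow> A \<subseteq> verts G \<Longrightarrow> closed_nbhd G A \<subseteq> verts G"
  unfolding closed_nbhd_def using nbhd_subset by auto

lemma finite_nbhd: "simple_graph G \<Longrightarrow> finite (nbhd G A)"
  by (rule finite_subset[OF nbhd_subset]) (simp_all add: simple_graph_def)

lemma card_closed_nbhd:
  assumes "simple_graph G" "independent G A"
  shows "card (closed_nbhd G A) = card (nbhd G A) + card A"
  unfolding closed_nbhd_def
proof (rule card_Un_disjoint)
  show "nbhd G A \<inter> A = {}"
    using assms unfolding nbhd_def independent_def by blast
qed (use assms finite_nbhd independent_finite in auto)

section \<open>Isomorphisms\<close>

text \<open>The vertex types may differ, since functions on an index set are to be compared with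
  pairs.\<close>

definition graph_iso :: "('a, 'c) sgraph_scheme \<Rightarrow> ('b, 'd) sgraph_scheme \<Rightarrow> ('a \<Rightarrow> 'b) \<Rightarrow> bool" where
  "graph_iso G H f \<longleftrightarrow> bij_betw f (verts G) (verts H)
     \<and> (\<forall>u\<in>verts G. \<forall>v\<in>verts G. adj G u v \<longleftrightarrow> adj H (f u) (f v))"

lemma graph_automorphism_iff_iso: "graph_automorphism G f \<longleftrightarrow> graph_iso G G f"
  by (simp add: graph_automorphism_def graph_iso_def)

lemma graph_iso_inv:
  assumes "graph_iso G H f"
  shows "graph_iso H G (inv_into (verts G) f)"
  unfolding graph_iso_def
proof (intro conjI ballI)
  have bij: "bij_betw f (verts G) (verts H)"
    using assms by (simp add: graph_iso_def)
  then show "bij_betw (inv_into (verts G) f) (verts H) (verts G)"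
    by (rule bij_betw_inv_into)
  fix u v assume uv: "u \<in> verts H" "v \<in> verts H"
  have "inv_into (verts G) f w \<in> verts G" "f (inv_into (verts G) f w) = w" if "w \<in> verts H" for w
    using bij that by (auto simp: bij_betw_def inv_into_into f_inv_into_f)
  then show "adj H u v \<longleftrightarrow> adj G (inv_into (verts G) f u) (inv_into (verts G) f v)"
    using assms uv by (simp add: graph_iso_def)
qed

lemma graph_iso_comp:
  assumes "graph_iso G H f" "graph_iso H K g"
  shows "graph_iso G K (g \<circ> f)"
  unfolding graph_iso_def
proof (intro conjI ballI)
  show "bij_betw (g \<circ> f) (verts G) (verts K)"
    using assms bij_betw_trans by (auto simp: graph_iso_def)
  fix u v assume "u \<in> verts G" "v \<in> verts G"
  moreover from this have "f u \<in> verts H" "f v \<in> verts H"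
    using assms(1) by (auto simp: graph_iso_def bij_betw_def)
  ultimately show "adj G u v \<longleftrightarrow> adj K ((g \<circ> f) u) ((g \<circ> f) v)"
    using assms by (simp add: graph_iso_def)
qed

lemma graph_iso_independent:
  assumes "graph_iso G H f" "A \<subseteq> verts G"
  shows "independent H (f ` A) \<longleftrightarrow> independent G A"
proof -
  have "f ` A \<subseteq> verts H"
    using assms unfolding graph_iso_def bij_betw_def by blast
  then show ?thesis
    using assms(2) subsetD[OF assms(2)] assms(1) unfolding graph_iso_def independent_def by simp
qed

lemma graph_iso_card_image:
  assumes "graph_iso G H f" "A \<subseteq> verts G"
  shows "card (f ` A) = card A"
  by (rule card_image, rule inj_on_subset[OF _ assms(2)])
    (use assms(1) in \<open>simp add: graph_iso_def bij_betw_def\<close>)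

lemma graph_iso_card_verts: "graph_iso G H f \<Longrightarrow> card (verts G) = card (verts H)"
  unfolding graph_iso_def using bij_betw_same_card by blast

lemma graph_iso_independent_cards:
  assumes "graph_iso G H f"
  shows "card ` {A. independent G A} \<subseteq> card ` {A. independent H A}"
proof
  fix k assume "k \<in> card ` {A. independent G A}"
  then obtain A where A: "independent G A" "k = card A"
    by blast
  then have "A \<subseteq> verts G"
    by (simp add: independent_def)
  then have "independent H (f ` A)" "card (f ` A) = k"
    using A graph_iso_independent[OF assms] graph_iso_card_image[OF assms] by simp_all
  then show "k \<in> card ` {A. independent H A}"
    by blast
qed

lemma graph_iso_alpha:
  assumes "graph_iso G H f"
  shows "alpha G = alpha H"
  unfolding alpha_def
  by (rule arg_cong[where f = Max], rule subset_antisym[OF graph_iso_independent_cards[OF assms]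
        graph_iso_independent_cards[OF graph_iso_inv[OF assms]]])

lemma graph_iso_ind_ratio: "graph_iso G H f \<Longrightarrow> ind_ratio G = ind_ratio H"
  unfolding ind_ratio_def by (simp add: graph_iso_alpha graph_iso_card_verts)

lemma graph_iso_max_independent:
  assumes "graph_iso G H f" "A \<subseteq> verts G"
  shows "max_independent H (f ` A) \<longleftrightarrow> max_independent G A"
  unfolding max_independent_def
  using graph_iso_independent[OF assms] graph_iso_card_image[OF assms] graph_iso_alpha[OF assms(1)]
  by simp

lemma graph_iso_nbhd:
  assumes "graph_iso G H f" "simple_graph G" "simple_graph H" "A \<subseteq> verts G"
  shows "nbhd H (f ` A) = f ` nbhd G A"
proof
  have im: "f ` verts G = verts H"
    using assms unfolding graph_iso_def bij_betw_def by blast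
  show "nbhd H (f ` A) \<subseteq> f ` nbhd G A"
  proof
    fix y assume "y \<in> nbhd H (f ` A)"
    then obtain a where a: "a \<in> A" "adj H (f a) y"
      by (auto simp: nbhd_def)
    then have "y \<in> f ` verts G"
      using adj_verts[OF assms(3)] im by blast
    then obtain b where "b \<in> verts G" "y = f b"
      by blast
    then show "y \<in> f ` nbhd G A"
      using a assms unfolding graph_iso_def nbhd_def by blast
  qed
  show "f ` nbhd G A \<subseteq> nbhd H (f ` A)"
    using assms adj_verts[OF assms(2)] unfolding graph_iso_def nbhd_def by blast
qed

lemma graph_iso_imprimitive:
  assumes "graph_iso G H f" "simple_graph G" "simple_graph H" "imprimitive G A"
  shows "imprimitive H (f ` A)"
proof -
  have A: "A \<subseteq> verts G"
    using assms(4) by (simp add: imprimitive_def independent_def)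
  have "closed_nbhd H (f ` A) = f ` closed_nbhd G A"
    unfolding closed_nbhd_def using graph_iso_nbhd[OF assms(1-3) A] by blast
  then have "card (closed_nbhd H (f ` A)) = card (closed_nbhd G A)"
    using graph_iso_card_image[OF assms(1)] closed_nbhd_subset[OF assms(2) A] by simp
  then show ?thesis
    using assms(4) graph_iso_independent[OF assms(1) A] graph_iso_card_image[OF assms(1) A]
      graph_iso_alpha[OF assms(1)] graph_iso_ind_ratio[OF assms(1)]
    unfolding imprimitive_def by simp
qed

lemma graph_iso_IS_primitive:
  assumes "graph_iso G H f" "simple_graph G" "simple_graph H" "IS_primitive H"
  shows "IS_primitive G"
  using graph_iso_imprimitive[OF assms(1-3)] assms(4) unfolding IS_primitive_def by blast

section \<open>Vertex-transitive graphs\<close>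

text \<open>Nonemptiness keeps the denominators of ratios positive. Connectedness stays a separate
  hypothesis because, unlike these three properties, it can be lost in a product.\<close>

definition vt_graph :: "('a, 'b) sgraph_scheme \<Rightarrow> bool" where
  "vt_graph G \<longleftrightarrow> simple_graph G \<and> vertex_transitive G \<and> verts G \<noteq> {}"

lemma vt_graph_simple: "vt_graph G \<Longrightarrow> simple_graph G"
  by (simp add: vt_graph_def)

lemma vt_graph_finite: "vt_graph G \<Longrightarrow> finite (verts G)"
  by (simp add: vt_graph_def simple_graph_def)

lemma vt_graph_card_pos: "vt_graph G \<Longrightarrow> card (verts G) > 0"
  using vt_graph_finite by (simp add: card_gt_0_iff vt_graph_def)

text \<open>Automorphisms of \<open>G\<close> become automorphisms of \<open>H\<close> by
  conjugation with \<open>f\<close>.\<close>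

lemma graph_iso_vertex_transitive:
  assumes "graph_iso G H f" "vertex_transitive G"
  shows "vertex_transitive H"
  unfolding vertex_transitive_def
proof (intro ballI)
  let ?g = "inv_into (verts G) f"
  have g: "graph_iso H G ?g"
    using graph_iso_inv[OF assms(1)] .
  fix u v assume uv: "u \<in> verts H" "v \<in> verts H"
  then have "?g u \<in> verts G" "?g v \<in> verts G"
    using g unfolding graph_iso_def by (meson bij_betw_apply)+
  then obtain h where h: "graph_iso G G h" "h (?g u) = ?g v"
    using assms(2) unfolding vertex_transitive_def graph_automorphism_iff_iso by blast
  have "graph_iso H H (f \<circ> (h \<circ> ?g))"
    using graph_iso_comp[OF graph_iso_comp[OF g h(1)] assms(1)] .
  moreover have "(f \<circ> (h \<circ> ?g)) u = v"
    using h uv assms(1) by (simp add: graph_iso_def bij_betw_def f_inv_into_f)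
  ultimately show "\<exists>f. graph_automorphism H f \<and> f u = v"
    unfolding graph_automorphism_iff_iso by blast
qed

lemma alpha_pos:
  assumes "vt_graph G"
  shows "alpha G > 0"
proof -
  obtain v where "v \<in> verts G"
    using assms by (auto simp: vt_graph_def)
  then have "independent G {v}"
    using vt_graph_simple[OF assms] by (simp add: independent_def simple_graph_def)
  then have "card {v} \<le> alpha G"
    by (rule card_le_alpha[OF vt_graph_simple[OF assms]])
  then show ?thesis
    by simp
qed

lemma ind_ratio_pos: "vt_graph G \<Longrightarrow> ind_ratio G > 0"
  unfolding ind_ratio_def using alpha_pos vt_graph_card_pos by fastforce

lemma real_alpha: "vt_graph G \<Longrightarrow> real (alpha G) = ind_ratio G * card (verts G)"
  unfolding ind_ratio_def using vt_graph_card_pos by fastforce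

text \<open>The counting behind the no-homomorphism lemma of Albertson and Collins. Over all maximum
  independent sets S, the average of |S Int B| is |B| \<open>alpha G\<close> / |V|, because every
  vertex lies in the same number \<open>c\<close> of them; some S reaches the average.\<close>

lemma no_homomorphism:
  assumes vt: "vt_graph G" and B: "B \<subseteq> verts G"
  shows "\<exists>S. max_independent G S \<and> alpha G * card B \<le> card (S \<inter> B) * card (verts G)"
proof (rule ccontr)
  assume neg: "\<not> ?thesis"
  note simple = vt_graph_simple[OF vt]
  define F where "F = {S. max_independent G S}"
  define c where "c u = card {S\<in>F. u \<in> S}" for u
  have finF: "finite F"
    unfolding F_def
    by (rule finite_subset[OF _ finite_independent_sets[OF simple]]) (auto simp: max_independent_def)
  have neF: "F \<noteq> {}"
    unfolding F_def using ex_max_independent[OF simple] by auto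
  have Fsub: "S \<subseteq> verts G" if "S \<in> F" for S
    using that by (simp add: F_def max_independent_def independent_def)
  \<comment> \<open>An automorphism taking \<open>u\<close> to \<open>v\<close> maps the maximum
    independent sets through \<open>u\<close> injectively to those through \<open>v\<close>.\<close>
  have c_le: "c u \<le> c v" if uv: "u \<in> verts G" "v \<in> verts G" for u v
  proof -
    obtain f where f: "graph_iso G G f" "f u = v"
      using vt uv unfolding vt_graph_def vertex_transitive_def graph_automorphism_iff_iso by blast
    have inj: "inj_on f (verts G)"
      using f by (simp add: graph_iso_def bij_betw_def)
    show ?thesis
      unfolding c_def
    proof (rule card_inj_on_le[where f = "(`) f"])
      show "inj_on ((`) f) {S \<in> F. u \<in> S}"
        by (rule inj_on_subset[OF inj_on_image_Pow[OF inj]]) (use Fsub in auto)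
      show "(`) f ` {S \<in> F. u \<in> S} \<subseteq> {S \<in> F. v \<in> S}"
        using f graph_iso_max_independent[OF f(1)] Fsub unfolding F_def by blast
    qed (use finF in auto)
  qed
  obtain v0 where v0: "v0 \<in> verts G"
    using vt by (auto simp: vt_graph_def)
  have c_eq: "c u = c v0" if "u \<in> verts G" for u
    using c_le v0 that by (simp add: le_antisym)
  \<comment> \<open>Double counting of incidences, stated for general \<open>X\<close>:
    \<open>X = verts G\<close> determines \<open>c v0\<close>, and \<open>X = B\<close> gives the
    sum to be compared with it.\<close>
  have count: "(\<Sum>S\<in>F. card (S \<inter> X)) = card X * c v0" if X: "X \<subseteq> verts G" for X
  proof -
    have finX: "finite X"
      using X vt_graph_finite[OF vt] finite_subset by blast
    have "(\<Sum>S\<in>F. card (S \<inter> X)) = (\<Sum>S\<in>F. \<Sum>b\<in>X. if b \<in> S then 1 else 0)"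
      using finX by (intro sum.cong refl) (simp add: sum.If_cases Int_def conj_commute)
    also have "\<dots> = (\<Sum>b\<in>X. \<Sum>S\<in>F. if b \<in> S then 1 else 0)"
      by (rule sum.swap)
    also have "\<dots> = (\<Sum>b\<in>X. c b)"
      unfolding c_def using finF by (intro sum.cong refl) (simp add: sum.If_cases Int_def)
    also have "\<dots> = card X * c v0"
      using c_eq X by (simp add: subset_iff)
    finally show ?thesis .
  qed
  have "card F * alpha G = (\<Sum>S\<in>F. card (S \<inter> verts G))"
  proof -
    have "card (S \<inter> verts G) = alpha G" if "S \<in> F" for S
      using that Fsub[OF that] by (simp add: F_def max_independent_def Int_absorb2)
    then show ?thesis
      by simp
  qed
  also have "\<dots> = card (verts G) * c v0"
    by (rule count) simp
  finally have all: "card F * alpha G = card (verts G) * c v0" .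
  have "(\<Sum>S\<in>F. card (S \<inter> B) * card (verts G)) < (\<Sum>S\<in>F. alpha G * card B)"
    by (rule sum_strict_mono) (use finF neF neg F_def in auto)
  also have "\<dots> = card B * (card F * alpha G)"
    by simp
  also have "\<dots> = card B * c v0 * card (verts G)"
    unfolding all by simp
  also have "\<dots> = (\<Sum>S\<in>F. card (S \<inter> B) * card (verts G))"
    using count[OF B] by (simp flip: sum_distrib_right)
  finally show False
    by simp
qed

text \<open>No vertex outside N[A] is adjacent to A, so any independent set found there can be
  joined to A. Averaging with \<open>B\<close> the complement of N[A] supplies one with at least the
  share \<open>ind_ratio G\<close> of that complement.\<close>

lemma independent_extend:
  assumes vt: "vt_graph G" and A: "independent G A"
  shows "\<exists>S. independent G S \<and> A \<subseteq> S \<and>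
    real (card A) + ind_ratio G * (real (card (verts G)) - real (card (closed_nbhd G A))) \<le> real (card S)"
proof -
  note simple = vt_graph_simple[OF vt]
  define B where "B = verts G - closed_nbhd G A"
  have AV: "A \<subseteq> verts G"
    using A by (simp add: independent_def)
  obtain T where T: "max_independent G T" "alpha G * card B \<le> card (T \<inter> B) * card (verts G)"
    using no_homomorphism[OF vt, of B] unfolding B_def by blast
  have "independent G (A \<union> (T \<inter> B))"
    using A T(1) adj_sym[OF simple]
    unfolding independent_def max_independent_def B_def closed_nbhd_def nbhd_def by blast
  moreover have "card (A \<union> (T \<inter> B)) = card A + card (T \<inter> B)"
  proof (rule card_Un_disjoint)
    show "finite A" "finite (T \<inter> B)"
      using independent_finite[OF simple] A T(1) by (auto simp: max_independent_def)
    show "A \<inter> (T \<inter> B) = {}"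
      unfolding B_def closed_nbhd_def by blast
  qed
  moreover have "real (card B) = real (card (verts G)) - real (card (closed_nbhd G A))"
    unfolding B_def using closed_nbhd_subset[OF simple AV] vt_graph_finite[OF vt]
    by (simp add: card_Diff_subset finite_subset card_mono of_nat_diff)
  moreover have "ind_ratio G * real (card B) \<le> real (card (T \<inter> B))"
  proof -
    have "real (alpha G * card B) \<le> real (card (T \<inter> B) * card (verts G))"
      using T(2) of_nat_mono by blast
    then show ?thesis
      unfolding ind_ratio_def using vt_graph_card_pos[OF vt] by (simp add: field_simps)
  qed
  ultimately show ?thesis
    by (intro exI[of _ "A \<union> (T \<inter> B)"]) auto
qed

text \<open>The extension of A has at most \<open>alpha G\<close> = r |V| elements, and r |V|
  cancels.\<close>

lemma card_le_ratio_closed_nbhd: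
  assumes vt: "vt_graph G" and A: "independent G A"
  shows "real (card A) \<le> ind_ratio G * real (card (closed_nbhd G A))"
proof -
  obtain S where S: "independent G S"
    "real (card A) + ind_ratio G * (real (card (verts G)) - real (card (closed_nbhd G A))) \<le> real (card S)"
    using independent_extend[OF assms] by blast
  moreover have "real (card S) \<le> real (alpha G)"
    using card_le_alpha[OF vt_graph_simple[OF vt] S(1)] by simp
  ultimately show ?thesis
    using real_alpha[OF vt] by (simp add: algebra_simps)
qed

text \<open>In the equality case the extension has r |V| elements. This places an imprimitive set of
  a product inside a maximum independent set whose shape is known.\<close>

lemma extend_to_max_independent:
  assumes vt: "vt_graph G" and A: "independent G A"
    and eq: "real (card A) = ind_ratio G * real (card (closed_nbhd G A))"
  shows "\<exists>S. max_independent G S \<and> A \<subseteq> S"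
proof -
  obtain S where S: "independent G S" "A \<subseteq> S"
    "real (card A) + ind_ratio G * (real (card (verts G)) - real (card (closed_nbhd G A))) \<le> real (card S)"
    using independent_extend[OF vt A] by blast
  then have "real (alpha G) \<le> real (card S)"
    using eq real_alpha[OF vt] by (simp add: algebra_simps)
  then have "card S = alpha G"
    using card_le_alpha[OF vt_graph_simple[OF vt] S(1)] by simp
  then show ?thesis
    using S by (auto simp: max_independent_def)
qed

text \<open>The denominator is cleared, so that imprimitivity becomes equality in
  \<open>card_le_ratio_closed_nbhd\<close>.\<close>

lemma imprimitive_iff:
  assumes vt: "vt_graph G"
  shows "imprimitive G A \<longleftrightarrow> independent G A \<and> A \<noteq> {} \<and> card A < alpha G
     \<and> real (card A) = ind_ratio G * real (card (closed_nbhd G A))"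
proof -
  have "real (card A) / real (card (closed_nbhd G A)) = ind_ratio G \<longleftrightarrow>
      real (card A) = ind_ratio G * real (card (closed_nbhd G A))"
    if "independent G A" "A \<noteq> {}"
  proof -
    have "card A > 0"
      using that independent_finite[OF vt_graph_simple[OF vt] that(1)] by (simp add: card_gt_0_iff)
    then have "real (card (closed_nbhd G A)) > 0"
      using card_closed_nbhd[OF vt_graph_simple[OF vt] that(1)] by simp
    then show ?thesis
      by (simp add: field_simps)
  qed
  then show ?thesis
    unfolding imprimitive_def by blast
qed

text \<open>A smaller nonempty tight set would be imprimitive. Once |A| = r |V|, tightness gives
  |N[A]| = |V|.\<close>

lemma IS_primitive_tight:
  assumes vt: "vt_graph G" and prim: "IS_primitive G" and A: "independent G A"
    and eq: "real (card A) = ind_ratio G * real (card (closed_nbhd G A))" and ne: "A \<noteq> {}"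
  shows "card A = alpha G" "closed_nbhd G A = verts G"
proof -
  note simple = vt_graph_simple[OF vt]
  show c: "card A = alpha G"
    using prim A eq ne card_le_alpha[OF simple A]
    unfolding IS_primitive_def imprimitive_iff[OF vt] by fastforce
  then have "card (closed_nbhd G A) = card (verts G)"
    using eq real_alpha[OF vt] ind_ratio_pos[OF vt] by simp
  moreover have "A \<subseteq> verts G"
    using A by (simp add: independent_def)
  ultimately show "closed_nbhd G A = verts G"
    using closed_nbhd_subset[OF simple] card_subset_eq[OF vt_graph_finite[OF vt]] by blast
qed

text \<open>The same inequality as an expansion bound, from |N[A]| = |N(A)| + |A|. The factor
  exceeds 1 exactly when the ratio is below 1/2.\<close>

lemma ratio_nbhd:
  assumes vt: "vt_graph G" and A: "independent G A"
  shows "(1 / ind_ratio G - 1) * real (card A) \<le> real (card (nbhd G A))"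
  using card_le_ratio_closed_nbhd[OF assms] card_closed_nbhd[OF vt_graph_simple[OF vt] A] ind_ratio_pos[OF vt]
  by (simp add: field_simps)

lemma connected_closed_set:
  assumes con: "connected_graph G" and X: "X \<subseteq> verts G" and cl: "nbhd G X \<subseteq> X"
  shows "X = {} \<or> X = verts G"
proof (rule ccontr)
  assume "\<not> ?thesis"
  then obtain u v where uv: "u \<in> X" "v \<in> verts G" "v \<notin> X"
    using X by blast
  then have "(adj G)\<^sup>*\<^sup>* u v"
    using con X unfolding connected_graph_def by blast
  then have "v \<in> X"
    using uv(1)
  proof induction
    case (step y z)
    then show ?case
      using cl unfolding nbhd_def by blast
  qed
  then show False
    using uv by simp
qed

text \<open>The expansion of a non-independent set reduces to that of its isolated vertices.\<close>

lemma card_nbhd_ge: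
  assumes vt: "vt_graph G" and con: "connected_graph G" and r: "ind_ratio G < 1/2" and X: "X \<subseteq> verts G"
  shows "card X \<le> card (nbhd G X)"
    and "card (nbhd G X) = card X \<Longrightarrow> X = {} \<or> X = verts G"
proof -
  note simple = vt_graph_simple[OF vt]
  define A where "A = X - nbhd G X"
  have fin: "finite X"
    using X vt_graph_finite[OF vt] finite_subset by blast
  have A: "independent G A"
    using X unfolding A_def independent_def nbhd_def by blast
  \<comment> \<open>Vertices of \<open>A\<close> have no neighbour in \<open>X\<close>, so
    \<open>nbhd G A\<close> is a part of \<open>nbhd G X\<close> disjoint from
    \<open>X\<close>.\<close>
  have "card ((X \<inter> nbhd G X) \<union> nbhd G A) = card (X \<inter> nbhd G X) + card (nbhd G A)"
  proof (rule card_Un_disjoint)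
    show "X \<inter> nbhd G X \<inter> nbhd G A = {}"
      using adj_sym[OF simple] unfolding A_def nbhd_def by blast
  qed (use fin finite_nbhd[OF simple] in auto)
  moreover have "card ((X \<inter> nbhd G X) \<union> nbhd G A) \<le> card (nbhd G X)"
    by (rule card_mono[OF finite_nbhd[OF simple]]) (auto simp: A_def nbhd_def)
  ultimately have ge: "card (X \<inter> nbhd G X) + card (nbhd G A) \<le> card (nbhd G X)"
    by simp
  have split: "card X = card (X \<inter> nbhd G X) + card A"
    unfolding A_def using fin by (metis card_Int_Diff)
  have gt: "card A < card (nbhd G A)" if "A \<noteq> {}"
  proof -
    have "0 < real (card A)"
      using that independent_finite[OF simple A] by (simp add: card_gt_0_iff)
    moreover have "1 < 1 / ind_ratio G - 1"
      using r ind_ratio_pos[OF vt] by (simp add: field_simps)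
    ultimately have "1 * real (card A) < (1 / ind_ratio G - 1) * real (card A)"
      by (intro mult_strict_right_mono) auto
    then show ?thesis
      using ratio_nbhd[OF vt A] by linarith
  qed
  have le: "card A \<le> card (nbhd G A)"
    using gt by (cases "A = {}") auto
  then show "card X \<le> card (nbhd G X)"
    using split ge by linarith
  \<comment> \<open>Equality leaves no room for isolated vertices, so \<open>X\<close> lies in
    \<open>nbhd G X\<close>; equal sizes then make \<open>X\<close> closed under taking
    neighbours.\<close>
  assume eq: "card (nbhd G X) = card X"
  then have "A = {}"
    using gt split ge by fastforce
  then have "X \<subseteq> nbhd G X"
    unfolding A_def by blast
  then have "nbhd G X = X"
    using card_subset_eq[OF finite_nbhd[OF simple]] eq by metis
  then show "X = {} \<or> X = verts G"
    using connected_closed_set[OF con X] by simp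
qed

lemma vertex_transitive_regular:
  assumes vt: "vt_graph G" and uv: "u \<in> verts G" "v \<in> verts G"
  shows "card (nbhd G {u}) = card (nbhd G {v})"
proof -
  note simple = vt_graph_simple[OF vt]
  obtain f where f: "graph_iso G G f" "f u = v"
    using vt uv unfolding vt_graph_def vertex_transitive_def graph_automorphism_iff_iso by blast
  then have "nbhd G {v} = f ` nbhd G {u}"
    using graph_iso_nbhd[OF f(1) simple simple, of "{u}"] uv by simp
  then show ?thesis
    using graph_iso_card_image[OF f(1) nbhd_subset[OF simple]] by simp
qed

text \<open>With ratio 1/2, tightness means that \<open>N(A)\<close> is as large as \<open>A\<close>; by regularity \<open>N[A]\<close> is then a
  union of components.\<close>

lemma IS_primitive_half:
  assumes vt: "vt_graph G" and con: "connected_graph G" and r: "ind_ratio G = 1/2"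
  shows "IS_primitive G"
  unfolding IS_primitive_def
proof
  note simple = vt_graph_simple[OF vt]
  assume "\<exists>A. imprimitive G A"
  then obtain A where A: "independent G A" "A \<noteq> {}" "card A < alpha G"
    "real (card A) = 1/2 * real (card (closed_nbhd G A))"
    unfolding imprimitive_iff[OF vt] r by blast
  define Y where "Y = nbhd G A"
  have AV: "A \<subseteq> verts G"
    using A by (simp add: independent_def)
  have finA: "finite A" and finY: "finite Y"
    using independent_finite[OF simple A(1)] finite_nbhd[OF simple] by (auto simp: Y_def)
  have YV: "Y \<subseteq> verts G"
    unfolding Y_def by (rule nbhd_subset[OF simple])
  have cY: "card Y = card A"
    using A(4) card_closed_nbhd[OF simple A(1)] unfolding Y_def by simp
  obtain v0 where v0: "v0 \<in> A"
    using A by blast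
  define d where "d = card (nbhd G {v0})"
  have deg: "card (nbhd G {u}) = d" if "u \<in> verts G" for u
    unfolding d_def using vertex_transitive_regular[OF vt] that v0 AV by blast
  \<comment> \<open>The edges between \<open>A\<close> and \<open>Y\<close> are counted from both
    ends. All d |A| edges at \<open>A\<close> end in \<open>Y\<close>, and |Y| = |A|, so no edge at
    \<open>Y\<close> is left to go anywhere but to \<open>A\<close>.\<close>
  have "d * card A = (\<Sum>a\<in>A. card (nbhd G {a}))"
    using deg AV by (simp add: subset_iff)
  also have "\<dots> = (\<Sum>a\<in>A. \<Sum>y\<in>Y. if adj G a y then 1 else 0)"
  proof (rule sum.cong[OF refl])
    fix a assume "a \<in> A"
    then have "nbhd G {a} = {y\<in>Y. adj G a y}"
      unfolding Y_def nbhd_def by blast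
    then show "card (nbhd G {a}) = (\<Sum>y\<in>Y. if adj G a y then 1 else 0)"
      using finY by (simp add: sum.If_cases Int_def)
  qed
  also have "\<dots> = (\<Sum>y\<in>Y. \<Sum>a\<in>A. if adj G a y then 1 else 0)"
    by (rule sum.swap)
  also have "\<dots> = (\<Sum>y\<in>Y. card (nbhd G {y} \<inter> A))"
  proof (rule sum.cong[OF refl])
    fix y assume "y \<in> Y"
    have "nbhd G {y} \<inter> A = {a\<in>A. adj G a y}"
      using adj_sym[OF simple] unfolding nbhd_def by blast
    then show "(\<Sum>a\<in>A. if adj G a y then 1 else 0) = card (nbhd G {y} \<inter> A)"
      using finA by (simp add: sum.If_cases Int_def)
  qed
  finally have e: "(\<Sum>y\<in>Y. card (nbhd G {y} \<inter> A)) = (\<Sum>y\<in>Y. card (nbhd G {y}))"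
    using deg YV cY by (simp add: subset_iff mult.commute)
  have "card (nbhd G {y} \<inter> A) = card (nbhd G {y})" if "y \<in> Y" for y
  proof -
    have "card (nbhd G {y} \<inter> A) \<le> card (nbhd G {y})" for y
      by (intro card_mono finite_nbhd[OF simple]) auto
    then show ?thesis
      using sum_mono_inv[OF e] that finY by metis
  qed
  then have sub: "nbhd G {y} \<subseteq> A" if "y \<in> Y" for y
    using that card_subset_eq[OF finite_nbhd[OF simple], of "nbhd G {y} \<inter> A" "{y}"] by blast
  have "nbhd G (A \<union> Y) \<subseteq> A \<union> Y"
    using sub unfolding Y_def nbhd_def by blast
  then have "A \<union> Y = verts G"
    using connected_closed_set[OF con, of "A \<union> Y"] AV YV v0 by blast
  \<comment> \<open>Now |A| is half of |V|, that is \<open>alpha G\<close>, against the strict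
    inequality in imprimitivity.\<close>
  then have "real (card (verts G)) = 2 * real (card A)"
    using A(4) unfolding Y_def closed_nbhd_def by (simp add: Un_commute)
  then show False
    using A(3) real_alpha[OF vt] r by simp
qed

section \<open>Products of two graphs\<close>

text \<open>The binary product on pairs with independent vertex types, so that its first factor can
  be a product over an index set.\<close>

definition tensor :: "'a sgraph \<Rightarrow> 'b sgraph \<Rightarrow> ('a \<times> 'b) sgraph" where
  "tensor G H = \<lparr> verts = verts G \<times> verts H,
     adj = (\<lambda>x y. adj G (fst x) (fst y) \<and> adj H (snd x) (snd y)) \<rparr>"

lemma verts_tensor [simp]: "verts (tensor G H) = verts G \<times> verts H"
  by (simp add: tensor_def)

lemma adj_tensor [simp]: "adj (tensor G H) x y \<longleftrightarrow> adj G (fst x) (fst y) \<and> adj H (snd x) (snd y)"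
  by (simp add: tensor_def)

lemma simple_tensor:
  assumes "simple_graph G" "simple_graph H"
  shows "simple_graph (tensor G H)"
  unfolding simple_graph_def
proof (intro conjI allI impI)
  show "finite (verts (tensor G H))"
    using assms by (simp add: simple_graph_def)
  fix u v
  show "\<not> adj (tensor G H) v v"
    using assms by (simp add: simple_graph_def)
  assume "adj (tensor G H) u v"
  then have uv: "adj G (fst u) (fst v)" "adj H (snd u) (snd v)"
    by simp_all
  show "u \<in> verts (tensor G H)" "v \<in> verts (tensor G H)"
    using adj_verts[OF assms(1) uv(1)] adj_verts[OF assms(2) uv(2)] by (simp_all add: mem_Times_iff)
  show "adj (tensor G H) v u"
    using adj_sym[OF assms(1) uv(1)] adj_sym[OF assms(2) uv(2)] by simp
qed

lemma vt_tensor: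
  assumes G: "vt_graph G" and H: "vt_graph H"
  shows "vt_graph (tensor G H)"
  unfolding vt_graph_def
proof (intro conjI)
  show "simple_graph (tensor G H)"
    by (rule simple_tensor[OF vt_graph_simple[OF G] vt_graph_simple[OF H]])
  show "verts (tensor G H) \<noteq> {}"
    using G H by (simp add: vt_graph_def)
  show "vertex_transitive (tensor G H)"
    unfolding vertex_transitive_def
  proof (intro ballI)
    fix x y assume "x \<in> verts (tensor G H)" "y \<in> verts (tensor G H)"
    then have xy: "fst x \<in> verts G" "fst y \<in> verts G" "snd x \<in> verts H" "snd y \<in> verts H"
      by auto
    obtain f where f: "graph_iso G G f" "f (fst x) = fst y"
      using G xy unfolding vt_graph_def vertex_transitive_def graph_automorphism_iff_iso by blast
    obtain g where g: "graph_iso H H g" "g (snd x) = snd y"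
      using H xy unfolding vt_graph_def vertex_transitive_def graph_automorphism_iff_iso by blast
    have "bij_betw (map_prod f g) (verts G \<times> verts H) (verts G \<times> verts H)"
      using f(1) g(1) by (intro bij_betw_map_prod) (simp_all add: graph_iso_def)
    then have "graph_automorphism (tensor G H) (map_prod f g)"
      using f(1) g(1) by (auto simp: graph_automorphism_def graph_iso_def)
    moreover have "map_prod f g x = y"
      using f(2) g(2) by (simp add: prod_eq_iff)
    ultimately show "\<exists>f. graph_automorphism (tensor G H) f \<and> f x = y"
      by blast
  qed
qed

lemma graph_iso_swap: "graph_iso (tensor G H) (tensor H G) prod.swap"
  unfolding graph_iso_def
  by (auto simp: bij_betw_def inj_on_def)

section \<open>Fibres of an independent set of a binary product\<close>

lemma card_fibres_fst:
  assumes "finite V" "finite W" "S \<subseteq> V \<times> W"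
  shows "card S = (\<Sum>u\<in>V. card {v. (u, v) \<in> S})"
proof -
  have "S = (SIGMA u:V. {v. (u, v) \<in> S})"
    using assms by blast
  moreover have "finite {v. (u, v) \<in> S}" for u
    by (rule finite_subset[OF _ assms(2)]) (use assms(3) in blast)
  ultimately show ?thesis
    using card_SigmaI[OF assms(1), of "\<lambda>u. {v. (u, v) \<in> S}"] by simp
qed

lemma card_fibres_snd:
  assumes "finite V" "finite W" "S \<subseteq> V \<times> W"
  shows "card S = (\<Sum>v\<in>W. card {u. (u, v) \<in> S})"
proof -
  have "card S = card (prod.swap ` S)"
    by (simp add: card_image)
  also have "\<dots> = (\<Sum>v\<in>W. card {u. (v, u) \<in> prod.swap ` S})"
    by (rule card_fibres_fst) (use assms in auto)
  also have "\<dots> = (\<Sum>v\<in>W. card {u. (u, v) \<in> S})"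
    by (rule sum.cong) (auto intro: arg_cong[where f = card])
  finally show ?thesis .
qed

locale tensor_independent =
  fixes G :: "'a sgraph" and H :: "'b sgraph" and S :: "('a \<times> 'b) set"
  assumes vtG: "vt_graph G" and vtH: "vt_graph H" and indS: "independent (tensor G H) S"
begin

lemmas simpleG = vt_graph_simple[OF vtG]
lemmas simpleH = vt_graph_simple[OF vtH]
lemmas finG = vt_graph_finite[OF vtG]
lemmas finH = vt_graph_finite[OF vtH]

text \<open>\<open>isol u\<close> and \<open>act v\<close> are fibres in opposite directions: over \<open>u\<close> in \<open>G\<close> and over \<open>v\<close> in \<open>H\<close>.\<close>

definition isol :: "'a \<Rightarrow> 'b set" where
  "isol u = {v. (u, v) \<in> S \<and> (\<forall>v'. (u, v') \<in> S \<longrightarrow> \<not> adj H v v')}"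

definition act :: "'b \<Rightarrow> 'a set" where
  "act v = {u. (u, v) \<in> S \<and> (\<exists>v'. (u, v') \<in> S \<and> adj H v v')}"

definition P :: "('a \<times> 'b) set" where
  "P = {(u, v). u \<in> verts G \<and> v \<in> closed_nbhd H (isol u)}"

definition Q :: "('a \<times> 'b) set" where
  "Q = {(u, v). v \<in> verts H \<and> u \<in> closed_nbhd G (act v)}"

lemma S_subset: "S \<subseteq> verts G \<times> verts H"
  using indS by (simp add: independent_def)

lemma S_independent:
  assumes "(u, v) \<in> S" "(u', v') \<in> S" "adj G u u'" "adj H v v'"
  shows False
proof -
  have "\<not> adj (tensor G H) (u, v) (u', v')"
    using indS assms(1,2) unfolding independent_def by blast
  then show False
    using assms(3,4) by simp
qed

lemma isol_independent: "independent H (isol u)"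
  unfolding independent_def isol_def using S_subset by blast

lemma act_independent: "independent G (act v)"
  unfolding independent_def
proof (intro conjI ballI)
  show "act v \<subseteq> verts G"
    unfolding act_def using S_subset by blast
  fix u u' assume "u \<in> act v" "u' \<in> act v"
  then obtain v' where "(u, v') \<in> S" "adj H v v'" "(u', v) \<in> S"
    unfolding act_def by blast
  then show "\<not> adj G u u'"
    using S_independent adj_sym[OF simpleH] by blast
qed

lemma isol_subset: "isol u \<subseteq> verts H"
  using isol_independent by (simp add: independent_def)

lemma act_subset: "act v \<subseteq> verts G"
  using act_independent by (simp add: independent_def)

lemma P_subset: "P \<subseteq> verts G \<times> verts H"
  unfolding P_def using closed_nbhd_subset[OF simpleH isol_subset] by blast

lemma Q_subset: "Q \<subseteq> verts G \<times> verts H"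
  unfolding Q_def using closed_nbhd_subset[OF simpleG act_subset] by blast

text \<open>A common point (u,v) is excluded in four cases. Suppose v is isolated in the fibre over
  u: u in \<open>act v\<close> contradicts isolation, and an active (u',v) with u' ~ u has a partner
  (u',v') in S adjacent to (u,v). Suppose v is a neighbour of an isolated w: if (u,v) is in S, then
  w is not isolated, and if (u',v) is in S with u' ~ u, then (u,w) and (u',v) are adjacent in
  S.\<close>

lemma P_Q_disjoint: "P \<inter> Q = {}"
proof (rule ccontr)
  assume "P \<inter> Q \<noteq> {}"
  then obtain u v where p: "v \<in> nbhd H (isol u) \<or> v \<in> isol u" and q: "u \<in> nbhd G (act v) \<or> u \<in> act v"
    unfolding P_def Q_def closed_nbhd_def by blast
  have q': "(\<exists>u' v'. adj G u' u \<and> (u', v) \<in> S \<and> (u', v') \<in> S \<and> adj H v v') \<or>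
      (\<exists>v'. (u, v) \<in> S \<and> (u, v') \<in> S \<and> adj H v v')"
    using q unfolding nbhd_def act_def by blast
  from p show False
  proof
    assume "v \<in> isol u"
    then show False
      using q' S_independent adj_sym[OF simpleG] adj_sym[OF simpleH] unfolding isol_def by blast
  next
    assume "v \<in> nbhd H (isol u)"
    then obtain w where "(u, w) \<in> S" "adj H w v" "\<forall>v'. (u, v') \<in> S \<longrightarrow> \<not> adj H w v'"
      unfolding nbhd_def isol_def by blast
    then show False
      using q' S_independent adj_sym[OF simpleG] adj_sym[OF simpleH] by blast
  qed
qed

lemma card_S: "card S = (\<Sum>u\<in>verts G. card (isol u)) + (\<Sum>v\<in>verts H. card (act v))"
proof -
  let ?A = "{(u, v). v \<in> isol u}" and ?B = "{(u, v). u \<in> act v}"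
  have sub: "?A \<subseteq> verts G \<times> verts H" "?B \<subseteq> verts G \<times> verts H"
    using S_subset unfolding isol_def act_def by auto
  have "S = ?A \<union> ?B" "?A \<inter> ?B = {}"
    unfolding isol_def act_def by auto
  then have "card S = card ?A + card ?B"
    using card_Un_disjoint[of ?A ?B] sub finite_subset[OF _ finite_cartesian_product[OF finG finH]] by simp
  then show ?thesis
    using card_fibres_fst[OF finG finH sub(1)] card_fibres_snd[OF finG finH sub(2)] by simp
qed

lemma card_P: "card P = (\<Sum>u\<in>verts G. card (closed_nbhd H (isol u)))"
  using card_fibres_fst[OF finG finH P_subset] by (simp add: P_def)

lemma card_Q: "card Q = (\<Sum>v\<in>verts H. card (closed_nbhd G (act v)))"
  using card_fibres_snd[OF finG finH Q_subset] by (simp add: Q_def)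

lemma card_P_Q_le: "card P + card Q \<le> card (verts G) * card (verts H)"
proof -
  have "finite P" "finite Q"
    using finite_subset[OF _ finite_cartesian_product[OF finG finH]] P_subset Q_subset by auto
  then have "card P + card Q = card (P \<union> Q)"
    using card_Un_disjoint P_Q_disjoint by metis
  also have "\<dots> \<le> card (verts G \<times> verts H)"
    by (rule card_mono[OF finite_cartesian_product[OF finG finH]]) (use P_subset Q_subset in blast)
  finally show ?thesis
    by (simp add: card_cartesian_product)
qed

section \<open>The ratio bound and its equality case\<close>

context
  fixes r :: real
  assumes rG: "ind_ratio G \<le> r" and rH: "ind_ratio H \<le> r"
begin

lemma card_isol_le: "real (card (isol u)) \<le> r * real (card (closed_nbhd H (isol u)))"
  by (rule order_trans[OF card_le_ratio_closed_nbhd[OF vtH isol_independent]])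
    (rule mult_right_mono[OF rH], simp)

lemma card_act_le: "real (card (act v)) \<le> r * real (card (closed_nbhd G (act v)))"
  by (rule order_trans[OF card_le_ratio_closed_nbhd[OF vtG act_independent]])
    (rule mult_right_mono[OF rG], simp)

text \<open>The slack is written as a sum of nonnegative contributions of single fibres, so
  tightness of S makes each contribution vanish.\<close>

lemma deficit:
  "r * (real (card P) + real (card Q)) - real (card S) =
    (\<Sum>u\<in>verts G. r * real (card (closed_nbhd H (isol u))) - real (card (isol u))) +
    (\<Sum>v\<in>verts H. r * real (card (closed_nbhd G (act v))) - real (card (act v)))"
  unfolding card_S card_P card_Q by (simp add: sum_subtractf sum_distrib_left algebra_simps)

lemma r_pos: "r > 0"
  using rG ind_ratio_pos[OF vtG] by linarith

lemma r_card_P_Q_le: "r * (real (card P) + real (card Q)) \<le> r * (real (card (verts G)) * real (card (verts H)))"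
proof -
  have "real (card P + card Q) \<le> real (card (verts G) * card (verts H))"
    using card_P_Q_le by (rule of_nat_mono)
  then show ?thesis
    using r_pos by simp
qed

lemma card_S_le: "real (card S) \<le> r * (real (card (verts G)) * real (card (verts H)))"
proof -
  have "0 \<le> r * (real (card P) + real (card Q)) - real (card S)"
    unfolding deficit using card_isol_le card_act_le by (intro add_nonneg_nonneg sum_nonneg) auto
  then show ?thesis
    using r_card_P_Q_le by linarith
qed

context
  assumes tight: "real (card S) = r * (real (card (verts G)) * real (card (verts H)))"
begin

text \<open>Tightness and \<open>r_card_P_Q_le\<close> make the deficit at most 0, while its two
  sums are nonnegative. A zero deficit then leaves no vertex outside P and Q.\<close>

lemma tight_sums:
  "(\<Sum>u\<in>verts G. r * real (card (closed_nbhd H (isol u))) - real (card (isol u))) = 0"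
  "(\<Sum>v\<in>verts H. r * real (card (closed_nbhd G (act v))) - real (card (act v))) = 0"
  "card P + card Q = card (verts G) * card (verts H)"
proof -
  let ?x = "\<Sum>u\<in>verts G. r * real (card (closed_nbhd H (isol u))) - real (card (isol u))"
  let ?y = "\<Sum>v\<in>verts H. r * real (card (closed_nbhd G (act v))) - real (card (act v))"
  have nn: "?x \<ge> 0" "?y \<ge> 0"
    by (rule sum_nonneg, use card_isol_le card_act_le in auto)+
  moreover have le: "?x + ?y \<le> 0"
    using deficit r_card_P_Q_le tight by linarith
  ultimately show "?x = 0" "?y = 0"
    by linarith+
  then have "r * (real (card P) + real (card Q)) = r * (real (card (verts G)) * real (card (verts H)))"
    using deficit tight by linarith
  then have "real (card P + card Q) = real (card (verts G) * card (verts H))"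
    using r_pos by simp
  then show "card P + card Q = card (verts G) * card (verts H)"
    using of_nat_eq_iff by blast
qed

lemma isol_tight: "u \<in> verts G \<Longrightarrow> real (card (isol u)) = r * real (card (closed_nbhd H (isol u)))"
  using iffD1[OF sum_nonneg_eq_0_iff tight_sums(1)] finG card_isol_le by auto

lemma act_tight: "v \<in> verts H \<Longrightarrow> real (card (act v)) = r * real (card (closed_nbhd G (act v)))"
  using iffD1[OF sum_nonneg_eq_0_iff tight_sums(2)] finH card_act_le by auto

lemma P_Q_cover: "P \<union> Q = verts G \<times> verts H"
proof (rule card_subset_eq[OF finite_cartesian_product[OF finG finH]])
  have "finite P" "finite Q"
    using finite_subset[OF _ finite_cartesian_product[OF finG finH]] P_subset Q_subset by auto
  then show "card (P \<union> Q) = card (verts G \<times> verts H)"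
    using card_Un_disjoint[OF _ _ P_Q_disjoint] tight_sums(3) by (simp add: card_cartesian_product)
qed (use P_subset Q_subset in blast)

end

end

text \<open>Let v ~ v'. A point u of the fibre over v' is not a neighbour of the fibre over v, for
  that would be an edge inside S; as the closed neighbourhood of that fibre is everything, u belongs
  to it. By symmetry fibres agree along edges, hence everywhere. The edge \<open>v0 w0\<close> makes
  the common fibre independent.\<close>

lemma constant_fibres_snd:
  assumes con: "connected_graph H" and edge: "adj H v0 w0"
    and cover: "\<And>v. v \<in> verts H \<Longrightarrow> closed_nbhd G {u. (u, v) \<in> S} = verts G"
  shows "\<exists>I. independent G I \<and> S = I \<times> verts H"
proof -
  define F where "F v = {u. (u, v) \<in> S}" for v
  have step: "F v' \<subseteq> F v" if "adj H v v'" for v v'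
  proof
    fix u assume u: "u \<in> F v'"
    then have "u \<in> closed_nbhd G (F v)"
      using cover adj_verts[OF simpleH that] S_subset unfolding F_def by blast
    moreover have "u \<notin> nbhd G (F v)"
      using u that S_independent unfolding F_def nbhd_def by blast
    ultimately show "u \<in> F v"
      unfolding closed_nbhd_def by blast
  qed
  have v0: "v0 \<in> verts H" "w0 \<in> verts H"
    using adj_verts[OF simpleH edge] by auto
  have const: "F v = F v0" if "v \<in> verts H" for v
  proof -
    have "(adj H)\<^sup>*\<^sup>* v0 v"
      using con v0 that unfolding connected_graph_def by blast
    then show ?thesis
    proof induction
      case (step y z)
      then show ?case
        using \<open>\<And>v v'. adj H v v' \<Longrightarrow> F v' \<subseteq> F v\<close> adj_sym[OF simpleH] by blast
    qed simp
  qed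
  have "S = F v0 \<times> verts H"
  proof
    show "S \<subseteq> F v0 \<times> verts H"
      using S_subset const unfolding F_def by blast
    show "F v0 \<times> verts H \<subseteq> S"
      using const unfolding F_def by blast
  qed
  moreover have "independent G (F v0)"
    unfolding independent_def
  proof (intro conjI ballI)
    show "F v0 \<subseteq> verts G"
      using S_subset unfolding F_def by blast
    fix u u' assume "u \<in> F v0" "u' \<in> F v0"
    then have "(u, v0) \<in> S" "(u', w0) \<in> S"
      using const[OF v0(2)] unfolding F_def by auto
    then show "\<not> adj G u u'"
      using S_independent edge by blast
  qed
  ultimately show ?thesis
    by blast
qed

lemma constant_fibres_fst:
  assumes con: "connected_graph G" and edge: "adj G u0 w0"
    and cover: "\<And>u. u \<in> verts G \<Longrightarrow> closed_nbhd H {v. (u, v) \<in> S} = verts H"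
  shows "\<exists>I. independent H I \<and> S = verts G \<times> I"
proof -
  have "independent (tensor H G) (prod.swap ` S)"
    using graph_iso_independent[OF graph_iso_swap, of S G H] indS S_subset by simp
  then interpret swap: tensor_independent H G "prod.swap ` S"
    using vtG vtH by unfold_locales
  have "\<exists>I. independent H I \<and> prod.swap ` S = I \<times> verts G"
    by (rule swap.constant_fibres_snd[OF con edge]) (use cover in simp)
  then obtain I where I: "independent H I" "prod.swap ` S = I \<times> verts G"
    by blast
  then have "prod.swap ` prod.swap ` S = prod.swap ` (I \<times> verts G)"
    by simp
  then have "S = verts G \<times> I"
    by (simp add: image_comp product_swap)
  then show ?thesis
    using I(1) by blast
qed

end

text \<open>Vertex-transitive graphs are regular, so an isolated vertex means no edges at all and
  ratio 1.\<close>

lemma ex_neighbour: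
  assumes vt: "vt_graph G" and r: "ind_ratio G < 1" and v: "v \<in> verts G"
  shows "\<exists>w. adj G v w"
proof (rule ccontr)
  note simple = vt_graph_simple[OF vt]
  assume "\<not> ?thesis"
  then have "nbhd G {v} = {}"
    by (auto simp: nbhd_def)
  then have "nbhd G {u} = {}" if "u \<in> verts G" for u
    using vertex_transitive_regular[OF vt that v] finite_nbhd[OF simple, of "{u}"] by simp
  then have "independent G (verts G)"
    unfolding independent_def nbhd_def by blast
  then have "card (verts G) \<le> alpha G"
    by (rule card_le_alpha[OF simple])
  then show False
    using r vt_graph_card_pos[OF vt] unfolding ind_ratio_def by simp
qed

section \<open>Ratio and maximum independent sets of a binary product\<close>

lemma independent_tensor_fst:
  "independent G A \<Longrightarrow> independent (tensor G H) (A \<times> verts H)"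
  unfolding independent_def by auto

lemma ind_ratio_tensor_ge_fst:
  assumes G: "vt_graph G" and H: "vt_graph H"
  shows "ind_ratio G \<le> ind_ratio (tensor G H)"
proof -
  obtain A where A: "max_independent G A"
    using ex_max_independent[OF vt_graph_simple[OF G]] by blast
  then have "card (A \<times> verts H) \<le> alpha (tensor G H)"
    using card_le_alpha[OF vt_graph_simple[OF vt_tensor[OF G H]]] independent_tensor_fst
    unfolding max_independent_def by blast
  then have "alpha G * card (verts H) \<le> alpha (tensor G H)"
    using A by (simp add: card_cartesian_product max_independent_def)
  then have "real (alpha G * card (verts H)) \<le> real (alpha (tensor G H))"
    by (rule of_nat_mono)
  then show ?thesis
    using vt_graph_card_pos[OF G] vt_graph_card_pos[OF H]
    unfolding ind_ratio_def by (simp add: card_cartesian_product field_simps)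
qed

text \<open>The lower bound comes from cylinders over maximum independent sets of a factor, the
  upper bound from \<open>card_S_le\<close> with r the larger ratio.\<close>

lemma ind_ratio_tensor:
  assumes G: "vt_graph G" and H: "vt_graph H"
  shows "ind_ratio (tensor G H) = max (ind_ratio G) (ind_ratio H)"
proof (rule antisym)
  have "ind_ratio H \<le> ind_ratio (tensor G H)"
    using ind_ratio_tensor_ge_fst[OF H G] graph_iso_ind_ratio[OF graph_iso_swap, of H G] by simp
  then show "max (ind_ratio G) (ind_ratio H) \<le> ind_ratio (tensor G H)"
    using ind_ratio_tensor_ge_fst[OF G H] by simp
  obtain S where S: "max_independent (tensor G H) S"
    using ex_max_independent[OF vt_graph_simple[OF vt_tensor[OF G H]]] by blast
  then interpret tensor_independent G H S
    using G H by unfold_locales (auto simp: max_independent_def)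
  have "real (card S) \<le> max (ind_ratio G) (ind_ratio H) * (real (card (verts G)) * real (card (verts H)))"
    by (rule card_S_le) simp_all
  then have "ind_ratio (tensor G H) * (real (card (verts G)) * real (card (verts H))) \<le>
      max (ind_ratio G) (ind_ratio H) * (real (card (verts G)) * real (card (verts H)))"
    using S real_alpha[OF vt_tensor[OF G H]] by (simp add: max_independent_def card_cartesian_product)
  then show "ind_ratio (tensor G H) \<le> max (ind_ratio G) (ind_ratio H)"
    using vt_graph_card_pos[OF G] vt_graph_card_pos[OF H] by (simp add: mult_le_cancel_right)
qed

lemma card_max_independent_tensor:
  assumes "vt_graph G" "vt_graph H" "max_independent (tensor G H) S"
  shows "real (card S) = max (ind_ratio G) (ind_ratio H) * (real (card (verts G)) * real (card (verts H)))"
  using assms real_alpha[OF vt_tensor[OF assms(1,2)]] ind_ratio_tensor[OF assms(1,2)]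
  by (simp add: max_independent_def card_cartesian_product)

text \<open>The factor with the smaller ratio cannot carry tight sets, so no point of S is isolated
  in its fibre. Connectedness is asked of \<open>H\<close>, the appended factor; \<open>G\<close>
  will be a product, possibly a disconnected one.\<close>

lemma tensor_normal_greater:
  assumes G: "vt_graph G" and H: "vt_graph H" and con: "connected_graph H"
    and less: "ind_ratio H < ind_ratio G" "ind_ratio H < 1"
    and S: "max_independent (tensor G H) S"
  shows "\<exists>I. independent G I \<and> S = I \<times> verts H"
proof -
  interpret tensor_independent G H S
    using G H S by unfold_locales (auto simp: max_independent_def)
  have le: "ind_ratio G \<le> ind_ratio G" "ind_ratio H \<le> ind_ratio G"
    using less by auto
  have tight: "real (card S) = ind_ratio G * (real (card (verts G)) * real (card (verts H)))"
    using card_max_independent_tensor[OF G H S] less by simp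
  obtain v0 where "v0 \<in> verts H"
    using H by (auto simp: vt_graph_def)
  then obtain w0 where edge: "adj H v0 w0"
    using ex_neighbour[OF H less(2)] by blast
  \<comment> \<open>A nonempty \<open>isol u\<close> would satisfy |isol u| = r |N[isol u]| with r
    the ratio of \<open>G\<close>, more than the ratio of \<open>H\<close> allows.\<close>
  have isol_empty: "isol u = {}" if "u \<in> verts G" for u
  proof (rule ccontr)
    assume "isol u \<noteq> {}"
    moreover have "finite (isol u)"
      using isol_subset finH finite_subset by blast
    ultimately have "card (isol u) > 0"
      by (simp add: card_gt_0_iff)
    then have pos: "real (card (closed_nbhd H (isol u))) > 0"
      using card_closed_nbhd[OF simpleH isol_independent] by simp
    have "ind_ratio G * real (card (closed_nbhd H (isol u))) \<le> ind_ratio H * real (card (closed_nbhd H (isol u)))"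
      using isol_tight[OF le tight that] card_le_ratio_closed_nbhd[OF H isol_independent[of u]] by simp
    then show False
      using pos less by simp
  qed
  have "P = {}"
    using isol_empty unfolding P_def closed_nbhd_def nbhd_def by auto
  then have Q: "Q = verts G \<times> verts H"
    using P_Q_cover[OF le tight] by simp
  have act: "act v = {u. (u, v) \<in> S}" for v
    using isol_empty S_subset unfolding act_def isol_def by blast
  show ?thesis
  proof (rule constant_fibres_snd[OF con edge])
    fix v assume v: "v \<in> verts H"
    have "verts G \<subseteq> closed_nbhd G (act v)"
      using Q v unfolding Q_def by blast
    then show "closed_nbhd G {u. (u, v) \<in> S} = verts G"
      using closed_nbhd_subset[OF simpleG act_subset] act by auto
  qed
qed

text \<open>Primitivity leaves each \<open>isol u\<close> and each \<open>act v\<close> either empty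
  or with closed neighbourhood the whole factor. A nonempty one of each kind would put a full row
  into P and a full column into Q, which would meet. So S is of one kind, and its fibres are
  constant.\<close>

lemma tensor_normal_primitive:
  assumes G: "vt_graph G" and H: "vt_graph H" and conG: "connected_graph G" and conH: "connected_graph H"
    and eq: "ind_ratio H = ind_ratio G" and less: "ind_ratio G < 1"
    and primG: "IS_primitive G" and primH: "IS_primitive H"
    and S: "max_independent (tensor G H) S"
  shows "(\<exists>I. independent G I \<and> S = I \<times> verts H) \<or> (\<exists>I. independent H I \<and> S = verts G \<times> I)"
proof -
  interpret tensor_independent G H S
    using G H S by unfold_locales (auto simp: max_independent_def)
  have le: "ind_ratio G \<le> ind_ratio G" "ind_ratio H \<le> ind_ratio G"
    using eq by auto
  have tight: "real (card S) = ind_ratio G * (real (card (verts G)) * real (card (verts H)))"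
    using card_max_independent_tensor[OF G H S] eq by simp
  have isol: "isol u = {} \<or> closed_nbhd H (isol u) = verts H" if "u \<in> verts G" for u
    using IS_primitive_tight(2)[OF H primH isol_independent] isol_tight[OF le tight that] eq by auto
  have act: "act v = {} \<or> closed_nbhd G (act v) = verts G" if "v \<in> verts H" for v
    using IS_primitive_tight(2)[OF G primG act_independent] act_tight[OF le tight that] by auto
  have cover: "(u, v) \<in> P \<or> (u, v) \<in> Q" if "u \<in> verts G" "v \<in> verts H" for u v
    using P_Q_cover[OF le tight] that by blast
  show ?thesis
  proof (cases "\<exists>u\<in>verts G. isol u \<noteq> {}")
    case True
    then obtain u0 where u0: "u0 \<in> verts G" "closed_nbhd H (isol u0) = verts H"
      using isol by blast
    have act_empty: "act v = {}" if "v \<in> verts H" for v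
    proof (rule ccontr)
      assume "act v \<noteq> {}"
      then have "(u0, v) \<in> P \<inter> Q"
        using act that u0 unfolding P_def Q_def by auto
      then show False
        using P_Q_disjoint by blast
    qed
    then have "Q = {}"
      unfolding Q_def closed_nbhd_def nbhd_def by auto
    have fib: "isol u = {v. (u, v) \<in> S}" for u
      using act_empty S_subset unfolding act_def isol_def by blast
    obtain w0 where edge: "adj G u0 w0"
      using ex_neighbour[OF G less u0(1)] by blast
    have "\<exists>I. independent H I \<and> S = verts G \<times> I"
    proof (rule constant_fibres_fst[OF conG edge])
      fix u assume u: "u \<in> verts G"
      have "verts H \<subseteq> closed_nbhd H (isol u)"
        using cover[OF u] \<open>Q = {}\<close> unfolding P_def by blast
      then show "closed_nbhd H {v. (u, v) \<in> S} = verts H"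
        using closed_nbhd_subset[OF simpleH isol_subset] fib by auto
    qed
    then show ?thesis
      by blast
  next
    case False
    then have "P = {}"
      unfolding P_def closed_nbhd_def nbhd_def by auto
    have fib: "act v = {u. (u, v) \<in> S}" for v
      using False S_subset unfolding act_def isol_def by blast
    obtain v0 where "v0 \<in> verts H"
      using H by (auto simp: vt_graph_def)
    then obtain w0 where edge: "adj H v0 w0"
      using ex_neighbour[OF H] less eq by auto
    have "\<exists>I. independent G I \<and> S = I \<times> verts H"
    proof (rule constant_fibres_snd[OF conH edge])
      fix v assume v: "v \<in> verts H"
      have "verts G \<subseteq> closed_nbhd G (act v)"
        using cover[OF _ v] \<open>P = {}\<close> unfolding Q_def by blast
      then show "closed_nbhd G {u. (u, v) \<in> S} = verts G"
        using closed_nbhd_subset[OF simpleG act_subset] fib by auto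
    qed
    then show ?thesis
      by blast
  qed
qed

text \<open>Count the neighbours of \<open>S\<close> over each \<open>v\<close>: they form \<open>N(D v)\<close> with
  \<open>|N(D v)| \<ge> (1/r - 1) |D v|\<close>, and \<open>\<Sum>\<^sub>v |D v| = \<Sum>\<^sub>u |N(X u)| \<ge> |S|\<close> by expansion in \<open>H\<close>. Tightness
  of \<open>S\<close> forces equality everywhere.\<close>

lemma tight_subset_block:
  assumes G: "vt_graph G" and H: "vt_graph H" and con: "connected_graph H"
    and eq: "ind_ratio H = ind_ratio G" and less: "ind_ratio G < 1/2"
    and prim: "IS_primitive G" and I: "independent G I" and sub: "S \<subseteq> I \<times> verts H"
    and tight: "real (card S) = ind_ratio G * real (card (closed_nbhd (tensor G H) S))"
  shows "S = {} \<or> S = I \<times> verts H"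
proof (cases "S = {}")
  case False
  let ?T = "tensor G H"
  define r where "r = ind_ratio G"
  define k where "k = 1 / r - 1"
  have r: "0 < r" "r < 1/2"
    using ind_ratio_pos[OF G] less by (auto simp: r_def)
  then have k: "k > 0"
    by (simp add: k_def field_simps)
  note simpleG = vt_graph_simple[OF G] and simpleH = vt_graph_simple[OF H]
  note finG = vt_graph_finite[OF G] and finH = vt_graph_finite[OF H]
  have simpleT: "simple_graph ?T"
    by (rule simple_tensor[OF simpleG simpleH])
  have IG: "I \<subseteq> verts G"
    using I by (simp add: independent_def)
  then have SV: "S \<subseteq> verts G \<times> verts H"
    using sub by blast
  have indS: "independent ?T S"
    by (rule independent_subset[OF independent_tensor_fst[OF I] sub])
  define X where "X u = {v. (u, v) \<in> S}" for u
  \<comment> \<open>The neighbours of \<open>S\<close> over \<open>v\<close> in \<open>H\<close> are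
    exactly the neighbours of \<open>D v\<close> in \<open>G\<close>.\<close>
  define D where "D v = {u. \<exists>v'. adj H v v' \<and> (u, v') \<in> S}" for v
  have XV: "X u \<subseteq> verts H" for u
    using SV unfolding X_def by blast
  have DI: "D v \<subseteq> I" for v
    using sub unfolding D_def by blast
  have indD: "independent G (D v)" for v
    by (rule independent_subset[OF I DI])
  have cS: "card S = (\<Sum>u\<in>verts G. card (X u))"
    using card_fibres_fst[OF finG finH SV] by (simp add: X_def)
  have cN: "card (nbhd ?T S) = (\<Sum>v\<in>verts H. card (nbhd G (D v)))"
  proof -
    have "{w. (w, v) \<in> nbhd ?T S} = nbhd G (D v)" for v
    proof (rule set_eqI)
      fix w
      have "w \<in> nbhd G (D v) \<longleftrightarrow> (\<exists>u v'. (u, v') \<in> S \<and> adj G u w \<and> adj H v v')"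
        unfolding nbhd_def D_def by blast
      also have "\<dots> \<longleftrightarrow> (\<exists>u v'. (u, v') \<in> S \<and> adj G u w \<and> adj H v' v)"
        using adj_sym[OF simpleH] by blast
      also have "\<dots> \<longleftrightarrow> w \<in> {w. (w, v) \<in> nbhd ?T S}"
        by (force simp: nbhd_def)
      finally show "w \<in> {w. (w, v) \<in> nbhd ?T S} \<longleftrightarrow> w \<in> nbhd G (D v)"
        by simp
    qed
    then show ?thesis
      using card_fibres_snd[OF finG finH, of "nbhd ?T S"] nbhd_subset[OF simpleT, of S] by simp
  qed
  \<comment> \<open>u is in \<open>D v\<close> iff v is in \<open>nbhd H (X u)\<close>; the pairs
    are counted in both orders.\<close>
  have cD: "(\<Sum>v\<in>verts H. card (D v)) = (\<Sum>u\<in>verts G. card (nbhd H (X u)))"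
  proof -
    let ?E = "{(u, v). u \<in> D v}"
    have E: "?E \<subseteq> verts G \<times> verts H"
      using SV adj_verts[OF simpleH] unfolding D_def by blast
    have "{v. (u, v) \<in> ?E} = nbhd H (X u)" for u
      unfolding nbhd_def D_def X_def using adj_sym[OF simpleH] by blast
    then show ?thesis
      using card_fibres_fst[OF finG finH E] card_fibres_snd[OF finG finH E] by simp
  qed
  have nn1: "0 \<le> real (card (nbhd G (D v))) - k * real (card (D v))" for v
    using ratio_nbhd[OF G indD[of v]] by (simp add: k_def r_def)
  have nn2: "0 \<le> real (card (nbhd H (X u))) - real (card (X u))" for u
    using card_nbhd_ge(1)[OF H con _ XV] less eq by simp
  have "real (card (nbhd ?T S)) = k * real (card S)"
    using tight card_closed_nbhd[OF simpleT indS] r unfolding k_def r_def[symmetric]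
    by (simp add: field_simps)
  \<comment> \<open>By \<open>cD\<close> this sum is |N(S)| - k |S|, which is 0; the terms with |D
    v| cancel against those with |N(X u)|.\<close>
  then have "(\<Sum>v\<in>verts H. real (card (nbhd G (D v))) - k * real (card (D v))) +
      k * (\<Sum>u\<in>verts G. real (card (nbhd H (X u))) - real (card (X u))) = 0"
    using arg_cong[OF cD, of real] arg_cong[OF cS, of real] arg_cong[OF cN, of real]
    by (simp add: sum_subtractf sum_distrib_left[symmetric] right_diff_distrib)
  moreover have s1: "0 \<le> (\<Sum>v\<in>verts H. real (card (nbhd G (D v))) - k * real (card (D v)))"
    by (rule sum_nonneg) (rule nn1)
  moreover have s2: "0 \<le> (\<Sum>u\<in>verts G. real (card (nbhd H (X u))) - real (card (X u)))"
    by (rule sum_nonneg) (rule nn2)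
  then have "0 \<le> k * (\<Sum>u\<in>verts G. real (card (nbhd H (X u))) - real (card (X u)))"
    using k by simp
  ultimately have z1: "(\<Sum>v\<in>verts H. real (card (nbhd G (D v))) - k * real (card (D v))) = 0"
    and z2': "k * (\<Sum>u\<in>verts G. real (card (nbhd H (X u))) - real (card (X u))) = 0"
    by linarith+
  from z2' k have z2: "(\<Sum>u\<in>verts G. real (card (nbhd H (X u))) - real (card (X u))) = 0"
    by simp
  have eqD: "real (card (nbhd G (D v))) = k * real (card (D v))" if "v \<in> verts H" for v
    using iffD1[OF sum_nonneg_eq_0_iff[OF finH nn1] z1] that by simp
  have eqX: "card (nbhd H (X u)) = card (X u)" if "u \<in> verts G" for u
    using iffD1[OF sum_nonneg_eq_0_iff[OF finG nn2] z2] that by simp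
  \<comment> \<open>Equality in the expansion bound is tightness of \<open>D v\<close>; primitivity
    makes it maximum, and it lies in the independent set \<open>I\<close>.\<close>
  have D01: "D v = {} \<or> D v = I" if "v \<in> verts H" for v
  proof (cases "D v = {}")
    case False
    have "real (card (D v)) = ind_ratio G * real (card (closed_nbhd G (D v)))"
      using eqD[OF that] card_closed_nbhd[OF simpleG indD[of v]] r unfolding k_def r_def[symmetric]
      by (simp add: field_simps)
    then have "card (D v) = alpha G"
      using IS_primitive_tight(1)[OF G prim indD _ False] by blast
    then have "card I \<le> card (D v)"
      using card_le_alpha[OF simpleG I] by simp
    then have "D v = I"
      using card_seteq[OF independent_finite[OF simpleG I] DI] by blast
    then show ?thesis ..
  qed simp
  have X01: "X u = {} \<or> X u = verts H" if "u \<in> verts G" for u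
    using card_nbhd_ge(2)[OF H con _ XV eqX[OF that]] less eq by simp
  obtain u0 v0 where uv0: "(u0, v0) \<in> S"
    using False by auto
  then obtain v1 where v1: "adj H v0 v1"
    using ex_neighbour[OF H, of v0] less eq SV by auto
  \<comment> \<open>One point of \<open>S\<close> makes one \<open>D v1\<close> nonempty, hence
    equal to \<open>I\<close>. Then no fibre over \<open>I\<close> is empty, so all are
    full.\<close>
  then have "u0 \<in> D v1"
    using uv0 adj_sym[OF simpleH] unfolding D_def by blast
  then have "D v1 = I"
    using D01 adj_verts[OF simpleH v1] by blast
  then have "X u \<noteq> {}" if "u \<in> I" for u
    using that unfolding D_def X_def by blast
  then have "X u = verts H" if "u \<in> I" for u
    using X01 that IG by blast
  then have "I \<times> verts H \<subseteq> S"
    unfolding X_def by blast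
  then show ?thesis
    using sub by blast
qed simp

text \<open>An imprimitive S lies in a maximum independent M, which is a cylinder over one of the
  factors. A nonempty tight subset of a cylinder is the whole of it, so S = M, which is too
  large.\<close>

lemma IS_primitive_tensor:
  assumes G: "vt_graph G" and H: "vt_graph H" and conG: "connected_graph G" and conH: "connected_graph H"
    and eq: "ind_ratio H = ind_ratio G" and less: "ind_ratio G < 1/2"
    and primG: "IS_primitive G" and primH: "IS_primitive H"
  shows "IS_primitive (tensor G H)"
  unfolding IS_primitive_def
proof
  let ?T = "tensor G H"
  have vtT: "vt_graph ?T"
    by (rule vt_tensor[OF G H])
  have ratio: "ind_ratio ?T = ind_ratio G"
    using ind_ratio_tensor[OF G H] eq by simp
  assume "\<exists>S. imprimitive ?T S"
  then obtain S where S: "independent ?T S" "S \<noteq> {}" "card S < alpha ?T"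
    "real (card S) = ind_ratio G * real (card (closed_nbhd ?T S))"
    unfolding imprimitive_iff[OF vtT] ratio by blast
  then obtain M where M: "max_independent ?T M" "S \<subseteq> M"
    using extend_to_max_independent[OF vtT] ratio by metis
  have "(\<exists>I. independent G I \<and> M = I \<times> verts H) \<or> (\<exists>I. independent H I \<and> M = verts G \<times> I)"
    by (rule tensor_normal_primitive[OF G H conG conH eq _ primG primH M(1)]) (use less in simp)
  then have "S = M"
  proof (elim disjE exE conjE)
    fix I assume "independent G I" "M = I \<times> verts H"
    then show "S = M"
      using tight_subset_block[OF G H conH eq less primG] M(2) S(2,4) by blast
  next
    fix I assume I: "independent H I" "M = verts G \<times> I"
    \<comment> \<open>\<open>tight_subset_block\<close> treats cylinders over the first factor; here
      it is applied with the coordinates exchanged.\<close>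
    let ?S = "prod.swap ` S"
    have SV: "S \<subseteq> verts ?T"
      using S(1) by (simp add: independent_def)
    have "closed_nbhd (tensor H G) ?S = prod.swap ` closed_nbhd ?T S"
      unfolding closed_nbhd_def
      using graph_iso_nbhd[OF graph_iso_swap vt_graph_simple[OF vtT] vt_graph_simple[OF vt_tensor[OF H G]] SV]
      by blast
    then have "real (card ?S) = ind_ratio H * real (card (closed_nbhd (tensor H G) ?S))"
      using S(4) eq by (simp add: card_image)
    moreover have "?S \<subseteq> I \<times> verts G"
      using M(2) I(2) by auto
    ultimately have "?S = I \<times> verts G"
      using tight_subset_block[OF H G conG eq[symmetric] _ primH I(1), of ?S] less eq S(2) by simp
    then have "prod.swap ` ?S = prod.swap ` (I \<times> verts G)"
      by simp
    then show "S = M"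
      using I(2) by (simp add: image_comp product_swap)
  qed
  then show False
    using M(1) S(3) by (simp add: max_independent_def)
qed

section \<open>Even walks\<close>

text \<open>Connectedness is not inherited by products (e.g. of two bipartite graphs); connectedness by walks
  of even length is.\<close>

definition even_connected :: "('a, 'b) sgraph_scheme \<Rightarrow> bool" where
  "even_connected G \<longleftrightarrow> (\<forall>u\<in>verts G. \<forall>v\<in>verts G. (adj G OO adj G)\<^sup>*\<^sup>* u v)"

lemma rtranclp_image:
  assumes "R\<^sup>*\<^sup>* u v" "\<And>x y. R x y \<Longrightarrow> R' (f x) (f y)"
  shows "R'\<^sup>*\<^sup>* (f u) (f v)"
  using assms(1) by induction (auto intro: rtranclp.rtrancl_into_rtrancl assms(2))

lemma symp_even_walk:
  assumes "simple_graph G"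
  shows "symp (adj G OO adj G)"
  using adj_sym[OF assms] by (intro sympI) blast

text \<open>The odd walk y, x, ..., z is paired off from its start instead of its end, which moves
  the single unpaired edge to the end.\<close>

lemma even_walk_shift:
  assumes simple: "simple_graph G" and "(adj G OO adj G)\<^sup>*\<^sup>* x z" and "adj G y x"
  shows "\<exists>y'. (adj G OO adj G)\<^sup>*\<^sup>* y y' \<and> adj G y' z"
  using assms(2)
proof induction
  case base
  then show ?case
    using assms(3) by blast
next
  case (step z z')
  then obtain y' t where "(adj G OO adj G)\<^sup>*\<^sup>* y y'" "adj G y' z" "adj G z t" "adj G t z'"
    by blast
  then show ?case
    by (meson relcomppI rtranclp.rtrancl_into_rtrancl)
qed

text \<open>If even walks from u did not reach everything, the even and the odd side would split the
  graph into two independent sets, one of them with at least half of the vertices.\<close>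

lemma even_connected_if_ratio_less_half:
  assumes simple: "simple_graph G" and con: "connected_graph G" and r: "ind_ratio G < 1/2"
  shows "even_connected G"
  unfolding even_connected_def
proof (intro ballI)
  let ?E = "(adj G OO adj G)\<^sup>*\<^sup>*"
  have sym: "?E x y \<Longrightarrow> ?E y x" for x y
    using sympD[OF symp_rtranclp[OF symp_even_walk[OF simple]]] .
  have fin: "finite (verts G)"
    using simple by (simp add: simple_graph_def)
  fix u v assume u: "u \<in> verts G" and v: "v \<in> verts G"
  define X where "X = {x. ?E u x}"
  define Y where "Y = nbhd G X"
  have XV: "X \<subseteq> verts G"
  proof
    fix x assume "x \<in> X"
    then have "?E u x"
      by (simp add: X_def)
    then show "x \<in> verts G"
      using u by induction (use adj_verts[OF simple] in blast)+
  qed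
  have YV: "Y \<subseteq> verts G"
    unfolding Y_def by (rule nbhd_subset[OF simple])
  have YX: "nbhd G Y \<subseteq> X"
  proof
    fix z assume "z \<in> nbhd G Y"
    then obtain x where "?E u x" "(adj G OO adj G) x z"
      unfolding Y_def X_def nbhd_def by blast
    then show "z \<in> X"
      unfolding X_def by simp
  qed
  have "u \<in> X"
    by (simp add: X_def)
  have "nbhd G (X \<union> Y) \<subseteq> X \<union> Y"
    using YX unfolding Y_def nbhd_def by blast
  then have cover: "X \<union> Y = verts G"
    using connected_closed_set[OF con, of "X \<union> Y"] XV YV \<open>u \<in> X\<close> by blast
  have "X \<inter> Y \<noteq> {}"
  proof
    assume disj: "X \<inter> Y = {}"
    then have "independent G X" "independent G Y"
      using XV YV YX unfolding independent_def Y_def nbhd_def by blast+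
    then have "card X \<le> alpha G" "card Y \<le> alpha G"
      using card_le_alpha[OF simple] by auto
    moreover have "card (verts G) = card X + card Y"
      using card_Un_disjoint[OF _ _ disj] finite_subset[OF XV fin] finite_subset[OF YV fin] cover by simp
    ultimately have le: "real (card (verts G)) \<le> 2 * real (alpha G)"
      by simp
    have "card (verts G) > 0"
      using u fin card_gt_0_iff by blast
    then show False
      using r le by (simp add: ind_ratio_def field_simps)
  qed
  then obtain w x1 where w: "w \<in> X" "x1 \<in> X" "adj G x1 w"
    unfolding Y_def nbhd_def by blast
  \<comment> \<open>\<open>w\<close> is reached from \<open>u\<close> with both parities. A vertex y
    of \<open>Y\<close> has an odd walk to \<open>x1\<close>, and the edge from \<open>x1\<close> to
    \<open>w\<close> makes it even.\<close>
  have "Y \<subseteq> X"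
  proof
    fix y assume "y \<in> Y"
    then obtain x where x: "x \<in> X" "adj G y x"
      using adj_sym[OF simple] unfolding Y_def nbhd_def by blast
    then have "?E x x1"
      using w(2) sym unfolding X_def by (blast intro: rtranclp_trans)
    then obtain y' where y': "?E y y'" "adj G y' x1"
      using even_walk_shift[OF simple _ x(2)] by blast
    then have "?E y w"
      using w(3) by (blast intro: rtranclp.rtrancl_into_rtrancl)
    then show "y \<in> X"
      using w(1) sym unfolding X_def by (blast intro: rtranclp_trans)
  qed
  then show "?E u v"
    using cover v unfolding X_def by blast
qed

lemma connected_if_even_connected:
  assumes "even_connected G" "verts G \<noteq> {}"
  shows "connected_graph G"
  unfolding connected_graph_def
proof (intro conjI ballI)
  fix u v assume "u \<in> verts G" "v \<in> verts G"
  then have "(adj G OO adj G)\<^sup>*\<^sup>* u v"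
    using assms(1) by (simp add: even_connected_def)
  then show "(adj G)\<^sup>*\<^sup>* u v"
    by induction (auto intro: rtranclp.rtrancl_into_rtrancl)
qed (rule assms(2))

text \<open>One coordinate follows its even walk while the other goes back and forth along an edge;
  even length brings it home. Then the roles are exchanged.\<close>

lemma even_connected_tensor:
  assumes "even_connected G" "even_connected H"
    and nG: "\<And>u. u \<in> verts G \<Longrightarrow> \<exists>w. adj G u w \<and> adj G w u"
    and nH: "\<And>v. v \<in> verts H \<Longrightarrow> \<exists>w. adj H v w \<and> adj H w v"
  shows "even_connected (tensor G H)"
  unfolding even_connected_def
proof (intro ballI)
  let ?E = "adj (tensor G H) OO adj (tensor G H)"
  fix x y assume "x \<in> verts (tensor G H)" "y \<in> verts (tensor G H)"
  then obtain u v u' v' where xy: "x = (u, v)" "y = (u', v')"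
    and V: "u \<in> verts G" "v \<in> verts H" "u' \<in> verts G" "v' \<in> verts H"
    by (cases x, cases y) auto
  obtain w where w: "adj H v w" "adj H w v"
    using nH[OF V(2)] by blast
  have "?E\<^sup>*\<^sup>* (u, v) (u', v)"
  proof (rule rtranclp_image[where f = "\<lambda>u. (u, v)" and R = "adj G OO adj G"])
    show "(adj G OO adj G)\<^sup>*\<^sup>* u u'"
      using assms(1) V by (simp add: even_connected_def)
    fix a b assume "(adj G OO adj G) a b"
    then obtain c where "adj G a c" "adj G c b"
      by blast
    then show "?E (a, v) (b, v)"
      using w by (intro relcomppI[of _ _ "(c, w)"]) simp_all
  qed
  moreover obtain t where t: "adj G u' t" "adj G t u'"
    using nG[OF V(3)] by blast
  have "?E\<^sup>*\<^sup>* (u', v) (u', v')"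
  proof (rule rtranclp_image[where f = "\<lambda>v. (u', v)" and R = "adj H OO adj H"])
    show "(adj H OO adj H)\<^sup>*\<^sup>* v v'"
      using assms(2) V by (simp add: even_connected_def)
    fix a b assume "(adj H OO adj H) a b"
    then obtain c where "adj H a c" "adj H c b"
      by blast
    then show "?E (u', a) (u', b)"
      using t by (intro relcomppI[of _ _ "(t, c)"]) simp_all
  qed
  ultimately show "?E\<^sup>*\<^sup>* x y"
    unfolding xy by (rule rtranclp_trans)
qed

lemma graph_iso_even_connected:
  assumes iso: "graph_iso G H f" and simple: "simple_graph G" and ec: "even_connected G"
  shows "even_connected H"
  unfolding even_connected_def
proof (intro ballI)
  have adj: "adj H (f x) (f y)" if "adj G x y" for x y
    using iso adj_verts[OF simple that] that by (simp add: graph_iso_def)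
  have im: "verts H = f ` verts G"
    using iso by (simp add: graph_iso_def bij_betw_def)
  fix u v assume "u \<in> verts H" "v \<in> verts H"
  then obtain a b where ab: "a \<in> verts G" "b \<in> verts G" "u = f a" "v = f b"
    unfolding im by blast
  have "(adj H OO adj H)\<^sup>*\<^sup>* (f a) (f b)"
  proof (rule rtranclp_image[where R = "adj G OO adj G"])
    show "(adj G OO adj G)\<^sup>*\<^sup>* a b"
      using ec ab by (simp add: even_connected_def)
    show "(adj H OO adj H) (f x) (f y)" if "(adj G OO adj G) x y" for x y
      using that adj by blast
  qed
  then show "(adj H OO adj H)\<^sup>*\<^sup>* u v"
    by (simp add: ab)
qed

lemma graph_iso_connected:
  assumes iso: "graph_iso G H f" and simple: "simple_graph G" and con: "connected_graph G"
  shows "connected_graph H"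
  unfolding connected_graph_def
proof (intro conjI ballI)
  have adj: "adj H (f x) (f y)" if "adj G x y" for x y
    using iso adj_verts[OF simple that] that by (simp add: graph_iso_def)
  have im: "verts H = f ` verts G"
    using iso by (simp add: graph_iso_def bij_betw_def)
  then show "verts H \<noteq> {}"
    using con by (simp add: connected_graph_def)
  fix u v assume "u \<in> verts H" "v \<in> verts H"
  then obtain a b where ab: "a \<in> verts G" "b \<in> verts G" "u = f a" "v = f b"
    unfolding im by blast
  then have "(adj G)\<^sup>*\<^sup>* a b"
    using con by (simp add: connected_graph_def)
  then have "(adj H)\<^sup>*\<^sup>* (f a) (f b)"
    by (rule rtranclp_image) (rule adj)
  then show "(adj H)\<^sup>*\<^sup>* u v"
    by (simp add: ab)
qed

section \<open>Products of finitely many graphs\<close>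

lemma verts_direct_prod [simp]: "verts (direct_prod I Gs) = PiE I (\<lambda>i. verts (Gs i))"
  by (simp add: direct_prod_def)

lemma adj_direct_prod:
  "adj (direct_prod I Gs) x y \<longleftrightarrow> x \<in> PiE I (\<lambda>i. verts (Gs i)) \<and> y \<in> PiE I (\<lambda>i. verts (Gs i))
     \<and> (\<forall>i\<in>I. adj (Gs i) (x i) (y i))"
  by (simp add: direct_prod_def)

text \<open>\<open>I\<close> must be nonempty: the empty product has one vertex, and its adjacency
  condition holds vacuously, which is a loop.\<close>

lemma simple_direct_prod:
  assumes "finite I" "I \<noteq> {}" "\<And>i. i \<in> I \<Longrightarrow> simple_graph (Gs i)"
  shows "simple_graph (direct_prod I Gs)"
  unfolding simple_graph_def
proof (intro conjI allI impI)
  show "finite (verts (direct_prod I Gs))"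
    using assms by (auto intro!: finite_PiE simp: simple_graph_def)
  fix u v
  show "\<not> adj (direct_prod I Gs) v v"
    using assms(2,3) by (auto simp: adj_direct_prod simple_graph_def)
  assume uv: "adj (direct_prod I Gs) u v"
  then show "u \<in> verts (direct_prod I Gs)" "v \<in> verts (direct_prod I Gs)"
    by (simp_all add: adj_direct_prod)
  show "adj (direct_prod I Gs) v u"
    using uv adj_sym[OF assms(3)] by (simp add: adj_direct_prod)
qed

lemma fun_upd_PiE: "w \<in> PiE I V \<Longrightarrow> i \<in> I \<Longrightarrow> a \<in> V i \<Longrightarrow> w(i := a) \<in> PiE I V"
  by (auto simp: PiE_iff extensional_def)

text \<open>This reduces induction on the index set to binary products. \<open>restrict\<close> is
  required because vertices over \<open>I\<close> are extensional functions.\<close>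

lemma graph_iso_insert:
  assumes k: "k \<notin> I"
  shows "graph_iso (direct_prod (insert k I) Gs) (tensor (direct_prod I Gs) (Gs k)) (\<lambda>x. (restrict x I, x k))"
  unfolding graph_iso_def
proof (intro conjI ballI)
  let ?f = "\<lambda>x. (restrict x I, x k)"
  let ?g = "\<lambda>(y, a). y(k := a)"
  show "bij_betw ?f (verts (direct_prod (insert k I) Gs)) (verts (tensor (direct_prod I Gs) (Gs k)))"
  proof (rule bij_betw_byWitness[where f' = ?g])
    show "\<forall>x\<in>verts (direct_prod (insert k I) Gs). ?g (?f x) = x"
    proof
      fix x assume "x \<in> verts (direct_prod (insert k I) Gs)"
      then have "x \<in> extensional (insert k I)"
        by (simp add: PiE_iff)
      then show "?g (?f x) = x"
        by (auto simp: fun_eq_iff extensional_def restrict_def)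
    qed
    show "\<forall>y\<in>verts (tensor (direct_prod I Gs) (Gs k)). ?f (?g y) = y"
    proof
      fix y assume "y \<in> verts (tensor (direct_prod I Gs) (Gs k))"
      then have "fst y \<in> extensional I"
        by (auto simp: PiE_iff)
      then have "restrict (fst y) I = fst y"
        by (rule extensional_restrict)
      then show "?f (?g y) = y"
        using k by (simp add: case_prod_beta prod_eq_iff)
    qed
    show "?f ` verts (direct_prod (insert k I) Gs) \<subseteq> verts (tensor (direct_prod I Gs) (Gs k))"
      by (auto simp: PiE_iff)
    show "?g ` verts (tensor (direct_prod I Gs) (Gs k)) \<subseteq> verts (direct_prod (insert k I) Gs)"
      using PiE_fun_upd[of _ "\<lambda>i. verts (Gs i)" k _ I] by (auto simp del: fun_upd_apply)
  qed
  fix u v assume "u \<in> verts (direct_prod (insert k I) Gs)" "v \<in> verts (direct_prod (insert k I) Gs)"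
  then show "adj (direct_prod (insert k I) Gs) u v \<longleftrightarrow> adj (tensor (direct_prod I Gs) (Gs k)) (?f u) (?f v)"
    by (auto simp: adj_direct_prod PiE_iff)
qed

lemma graph_iso_singleton: "graph_iso (direct_prod {i} Gs) (Gs i) (\<lambda>x. x i)"
  unfolding graph_iso_def
proof (intro conjI ballI)
  show "bij_betw (\<lambda>x. x i) (verts (direct_prod {i} Gs)) (verts (Gs i))"
    unfolding bij_betw_def
  proof
    show "inj_on (\<lambda>x. x i) (verts (direct_prod {i} Gs))"
      by (rule inj_onI) (auto intro: PiE_ext)
    show "(\<lambda>x. x i) ` verts (direct_prod {i} Gs) = verts (Gs i)"
    proof
      show "verts (Gs i) \<subseteq> (\<lambda>x. x i) ` verts (direct_prod {i} Gs)"
      proof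
        fix a assume "a \<in> verts (Gs i)"
        then have "(\<lambda>j\<in>{i}. a) \<in> verts (direct_prod {i} Gs)"
          by simp
        then show "a \<in> (\<lambda>x. x i) ` verts (direct_prod {i} Gs)"
          by (rule rev_image_eqI) simp
      qed
    qed auto
  qed
qed (simp add: adj_direct_prod)

lemma direct_prod_vt_ratio:
  assumes "finite I" "I \<noteq> {}" "\<And>i. i \<in> I \<Longrightarrow> vt_graph (Gs i)"
  shows "vt_graph (direct_prod I Gs) \<and> ind_ratio (direct_prod I Gs) = Max ((\<lambda>i. ind_ratio (Gs i)) ` I)"
  using assms
proof (induction I rule: finite_ne_induct)
  case (singleton i)
  have simple: "simple_graph (direct_prod {i} Gs)"
    using singleton vt_graph_simple by (intro simple_direct_prod) auto
  have "vertex_transitive (direct_prod {i} Gs)"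
    using graph_iso_vertex_transitive[OF graph_iso_inv[OF graph_iso_singleton]] singleton
    by (auto simp: vt_graph_def)
  moreover have "verts (direct_prod {i} Gs) \<noteq> {}"
    using singleton by (auto simp: PiE_eq_empty_iff vt_graph_def)
  ultimately show ?case
    using simple graph_iso_ind_ratio[OF graph_iso_singleton, of i Gs] by (simp add: vt_graph_def)
next
  case (insert k I)
  let ?K = "direct_prod I Gs" and ?L = "direct_prod (insert k I) Gs"
  have IH: "vt_graph ?K" "ind_ratio ?K = Max ((\<lambda>i. ind_ratio (Gs i)) ` I)"
    using insert by auto
  have vtk: "vt_graph (Gs k)"
    using insert by simp
  note iso = graph_iso_insert[OF insert.hyps(3), of Gs]
  have T: "vt_graph (tensor ?K (Gs k))"
    by (rule vt_tensor[OF IH(1) vtk])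
  have "simple_graph ?L"
    by (rule simple_direct_prod) (use insert.hyps insert.prems in \<open>auto intro: vt_graph_simple\<close>)
  moreover have "vertex_transitive ?L"
    using graph_iso_vertex_transitive[OF graph_iso_inv[OF iso]] T by (simp add: vt_graph_def)
  moreover have "verts ?L \<noteq> {}"
    using insert.prems by (auto simp: PiE_eq_empty_iff vt_graph_def)
  moreover have "ind_ratio ?L = Max ((\<lambda>i. ind_ratio (Gs i)) ` insert k I)"
    using graph_iso_ind_ratio[OF iso] ind_ratio_tensor[OF IH(1) vtk] IH(2) insert.hyps
    by (simp add: max.commute)
  ultimately show ?case
    by (simp add: vt_graph_def)
qed

lemma MIS_normal_singleton: "MIS_normal {i} Gs"
  unfolding MIS_normal_def
proof (intro allI impI)
  fix S assume "max_independent (direct_prod {i} Gs) S"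
  then have S: "independent (direct_prod {i} Gs) S"
    by (simp add: max_independent_def)
  let ?A = "(\<lambda>x. x i) ` S"
  have SV: "S \<subseteq> verts (direct_prod {i} Gs)"
    using S unfolding independent_def by blast
  have inj: "inj_on (\<lambda>x. x i) (verts (direct_prod {i} Gs))"
    using graph_iso_singleton[of i Gs] by (simp add: graph_iso_def bij_betw_def)
  have "independent (Gs i) ?A"
    using graph_iso_independent[OF graph_iso_singleton SV] S by simp
  moreover have "S = {x \<in> verts (direct_prod {i} Gs). x i \<in> ?A}"
    using SV inj_on_image_mem_iff[OF inj _ SV] by blast
  ultimately show "\<exists>j\<in>{i}. \<exists>A. independent (Gs j) A \<and> S = {x \<in> verts (direct_prod {i} Gs). x j \<in> A}"
    by blast
qed

text \<open>A block over the new factor is already of the required form. For a block over the old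
  product, its base \<open>J\<close> is itself maximum independent, so normality of the old product
  applies to \<open>J\<close>.\<close>

lemma MIS_normal_insert:
  assumes k: "k \<notin> I" and K: "vt_graph (direct_prod I Gs)" and vtk: "vt_graph (Gs k)"
    and le: "ind_ratio (Gs k) \<le> ind_ratio (direct_prod I Gs)" and norm: "MIS_normal I Gs"
    and block: "\<And>S. max_independent (tensor (direct_prod I Gs) (Gs k)) S \<Longrightarrow>
      (\<exists>J. independent (direct_prod I Gs) J \<and> S = J \<times> verts (Gs k)) \<or>
      (\<exists>J. independent (Gs k) J \<and> S = verts (direct_prod I Gs) \<times> J)"
  shows "MIS_normal (insert k I) Gs"
  unfolding MIS_normal_def
proof (intro allI impI)
  let ?K = "direct_prod I Gs" and ?L = "direct_prod (insert k I) Gs"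
  let ?f = "\<lambda>x. (restrict x I, x k)"
  note iso = graph_iso_insert[OF k, of Gs]
  fix S assume S: "max_independent ?L S"
  then have SV: "S \<subseteq> verts ?L"
    by (simp add: max_independent_def independent_def)
  have MT: "max_independent (tensor ?K (Gs k)) (?f ` S)"
    using graph_iso_max_independent[OF iso SV] S by simp
  have inj: "inj_on ?f (verts ?L)"
    using iso by (simp add: graph_iso_def bij_betw_def)
  have mem: "x \<in> S \<longleftrightarrow> x \<in> verts ?L \<and> ?f x \<in> ?f ` S" for x
    using inj_on_image_mem_iff[OF inj _ SV] SV by blast
  have fV: "restrict x I \<in> verts ?K \<and> x k \<in> verts (Gs k)" if "x \<in> verts ?L" for x
    using that by (auto simp: PiE_iff)
  from block[OF MT] show "\<exists>i\<in>insert k I. \<exists>A. independent (Gs i) A \<and> S = {x \<in> verts ?L. x i \<in> A}"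
  proof (elim disjE exE conjE)
    fix J assume J: "independent ?K J" "?f ` S = J \<times> verts (Gs k)"
    \<comment> \<open>By \<open>le\<close> the ratio of the whole is that of \<open>?K\<close>, so
      dividing by the size of the new factor shows that \<open>J\<close> is maximum.\<close>
    have "real (card J) * real (card (verts (Gs k))) =
        ind_ratio ?K * (real (card (verts ?K)) * real (card (verts (Gs k))))"
      using card_max_independent_tensor[OF K vtk MT] le unfolding J(2)
      by (simp add: card_cartesian_product max_absorb1)
    then have "real (card J) = real (alpha ?K)"
      using vt_graph_card_pos[OF vtk] real_alpha[OF K] by simp
    then have "max_independent ?K J"
      using J(1) by (simp add: max_independent_def)
    then obtain i A where iA: "i \<in> I" "independent (Gs i) A" "J = {x \<in> verts ?K. x i \<in> A}"
      using norm unfolding MIS_normal_def by blast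
    have "x \<in> S \<longleftrightarrow> x \<in> {x \<in> verts ?L. x i \<in> A}" for x
    proof (cases "x \<in> verts ?L")
      case True
      then have "x \<in> S \<longleftrightarrow> restrict x I \<in> J"
        using mem fV unfolding J(2) by blast
      also have "\<dots> \<longleftrightarrow> x i \<in> A"
        using fV[OF True] iA(1) unfolding iA(3) by simp
      finally show ?thesis
        using True by blast
    qed (use SV in blast)
    then show ?thesis
      using iA(1,2) by blast
  next
    fix J assume J: "independent (Gs k) J" "?f ` S = verts ?K \<times> J"
    have "x \<in> S \<longleftrightarrow> x \<in> {x \<in> verts ?L. x k \<in> J}" for x
      using mem fV unfolding J(2) by blast
    then show ?thesis
      using J(1) by blast
  qed
qed

text \<open>The three claims are proved together: normality after one more factor rests on
  primitivity and connectedness of the product so far. Even connectedness gives connectedness and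
  survives multiplication.\<close>

lemma direct_prod_primitive:
  assumes "finite I" "I \<noteq> {}" "\<And>i. i \<in> I \<Longrightarrow> vt_graph (Gs i)" "\<And>i. i \<in> I \<Longrightarrow> connected_graph (Gs i)"
    "\<And>i. i \<in> I \<Longrightarrow> IS_primitive (Gs i)" "\<And>i. i \<in> I \<Longrightarrow> ind_ratio (Gs i) = r" "r < 1/2"
  shows "even_connected (direct_prod I Gs) \<and> IS_primitive (direct_prod I Gs) \<and> MIS_normal I Gs"
  using assms(1-6)
proof (induction I rule: finite_ne_induct)
  case (singleton i)
  have simple: "simple_graph (direct_prod {i} Gs)" "simple_graph (Gs i)"
    using singleton vt_graph_simple by (auto intro!: simple_direct_prod)
  have "even_connected (Gs i)"
    using even_connected_if_ratio_less_half[OF simple(2)] singleton assms(7) by simp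
  then show ?case
    using graph_iso_even_connected[OF graph_iso_inv[OF graph_iso_singleton[of i Gs]] simple(2)]
      graph_iso_IS_primitive[OF graph_iso_singleton[of i Gs] simple] MIS_normal_singleton singleton
    by blast
next
  case (insert k I)
  let ?K = "direct_prod I Gs" and ?L = "direct_prod (insert k I) Gs"
  have IH: "even_connected ?K" "IS_primitive ?K" "MIS_normal I Gs"
    using insert by auto
  have vtk: "vt_graph (Gs k)" and conk: "connected_graph (Gs k)" and primk: "IS_primitive (Gs k)"
    and rk: "ind_ratio (Gs k) = r"
    using insert.prems by auto
  have "vt_graph ?K \<and> ind_ratio ?K = Max ((\<lambda>i. ind_ratio (Gs i)) ` I)"
    using insert by (intro direct_prod_vt_ratio) auto
  moreover have "(\<lambda>i. ind_ratio (Gs i)) ` I = {r}"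
    using insert.hyps insert.prems by auto
  ultimately have vtK: "vt_graph ?K" and rK: "ind_ratio ?K = r"
    by auto
  have conK: "connected_graph ?K"
    using connected_if_even_connected[OF IH(1)] vtK by (simp add: vt_graph_def)
  have simpleL: "simple_graph ?L"
    by (rule simple_direct_prod) (use insert.hyps insert.prems in \<open>auto intro: vt_graph_simple\<close>)
  note iso = graph_iso_insert[OF insert.hyps(3), of Gs]
  have simpleT: "simple_graph (tensor ?K (Gs k))"
    by (rule vt_graph_simple[OF vt_tensor[OF vtK vtk]])
  have less: "ind_ratio ?K < 1/2" "ind_ratio ?K < 1" "ind_ratio (Gs k) < 1" and eq: "ind_ratio (Gs k) = ind_ratio ?K"
    using rK rk assms(7) by auto
  have "even_connected (tensor ?K (Gs k))"
  proof (rule even_connected_tensor[OF IH(1)])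
    show "even_connected (Gs k)"
      using even_connected_if_ratio_less_half[OF vt_graph_simple[OF vtk] conk] rk assms(7) by simp
    show "\<exists>w. adj ?K u w \<and> adj ?K w u" if "u \<in> verts ?K" for u
      using ex_neighbour[OF vtK less(2) that] adj_sym[OF vt_graph_simple[OF vtK]] by blast
    show "\<exists>w. adj (Gs k) u w \<and> adj (Gs k) w u" if "u \<in> verts (Gs k)" for u
      using ex_neighbour[OF vtk less(3) that] adj_sym[OF vt_graph_simple[OF vtk]] by blast
  qed
  then have "even_connected ?L"
    by (rule graph_iso_even_connected[OF graph_iso_inv[OF iso] simpleT])
  moreover have "IS_primitive ?L"
    by (rule graph_iso_IS_primitive[OF iso simpleL simpleT
          IS_primitive_tensor[OF vtK vtk conK conk eq less(1) IH(2) primk]])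
  moreover have "MIS_normal (insert k I) Gs"
    by (rule MIS_normal_insert[OF insert.hyps(3) vtK vtk _ IH(3)
          tensor_normal_primitive[OF vtK vtk conK conk eq less(2) IH(2) primk]]) (use eq in simp_all)
  ultimately show ?case
    by blast
qed

section \<open>Products that are not MIS-normal\<close>

lemma card_cylinder:
  fixes V :: "'i \<Rightarrow> 'a set"
  assumes fin: "finite I" and J: "J \<subseteq> I" and V: "\<And>i. i \<in> I \<Longrightarrow> finite (V i) \<and> V i \<noteq> {}"
    and B: "\<And>i. i \<in> J \<Longrightarrow> B i \<subseteq> V i"
  shows "real (card {x \<in> PiE I V. \<forall>i\<in>J. x i \<in> B i}) =
    real (card (PiE I V)) * (\<Prod>i\<in>J. real (card (B i)) / real (card (V i)))"
proof -
  let ?q = "\<lambda>i. real (card (B i)) / real (card (V i))"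
  have "{x \<in> PiE I V. \<forall>i\<in>J. x i \<in> B i} = PiE I (\<lambda>i. if i \<in> J then B i else V i)"
  proof (rule set_eqI)
    fix x
    have "x i \<in> (if i \<in> J then B i else V i) \<longleftrightarrow> (i \<in> J \<longrightarrow> x i \<in> B i) \<and> (i \<notin> J \<longrightarrow> x i \<in> V i)" for i
      by simp
    then show "x \<in> {x \<in> PiE I V. \<forall>i\<in>J. x i \<in> B i} \<longleftrightarrow> x \<in> PiE I (\<lambda>i. if i \<in> J then B i else V i)"
      unfolding mem_Collect_eq PiE_iff using J B by blast
  qed
  then have "real (card {x \<in> PiE I V. \<forall>i\<in>J. x i \<in> B i}) = (\<Prod>i\<in>I. real (card (if i \<in> J then B i else V i)))"
    using fin by (simp add: card_PiE)
  also have "\<dots> = (\<Prod>i\<in>I. real (card (V i)) * (if i \<in> J then ?q i else 1))"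
    using V by (intro prod.cong) auto
  also have "\<dots> = (\<Prod>i\<in>I. real (card (V i))) * (\<Prod>i\<in>I. if i \<in> J then ?q i else 1)"
    by (rule prod.distrib)
  also have "(\<Prod>i\<in>I. if i \<in> J then ?q i else 1) = (\<Prod>i\<in>J. ?q i)"
    using prod.inter_restrict[OF fin, of ?q J] J by (simp add: Int_absorb1)
  finally show ?thesis
    using fin by (simp add: card_PiE)
qed

lemma max_independent_if_ratio:
  assumes "vt_graph G" "independent G S" "real (card S) = ind_ratio G * real (card (verts G))"
  shows "max_independent G S"
  using assms real_alpha[OF assms(1)] by (simp add: max_independent_def)

lemma independent_proper:
  assumes "vt_graph G" "ind_ratio G < 1" "independent G A"
  shows "\<exists>v. v \<in> verts G \<and> v \<notin> A"
proof (rule ccontr)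
  assume neg: "\<not> ?thesis"
  obtain v where "v \<in> verts G"
    using assms(1) by (auto simp: vt_graph_def)
  moreover from this obtain w where "adj G v w"
    using ex_neighbour[OF assms(1,2)] by blast
  ultimately show False
    using neg assms(3) adj_verts[OF vt_graph_simple[OF assms(1)]] unfolding independent_def by blast
qed

text \<open>\<open>S1\<close> and \<open>S2\<close> together are the set { x_p in A, or x_p outside
  N[A] and x_q in T }. It is independent since no edge joins A to the complement \<open>C\<close> of
  N[A].\<close>

lemma not_MIS_normal_imprimitive:
  assumes fin: "finite I" and vt: "\<And>i. i \<in> I \<Longrightarrow> vt_graph (Gs i)" and less: "\<And>i. i \<in> I \<Longrightarrow> ind_ratio (Gs i) < 1"
    and p: "p \<in> I" and q: "q \<in> I" "p \<noteq> q"
    and rp: "ind_ratio (Gs p) = ind_ratio (direct_prod I Gs)" and rq: "ind_ratio (Gs q) = ind_ratio (direct_prod I Gs)"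
    and A: "imprimitive (Gs p) A"
  shows "\<not> MIS_normal I Gs"
proof
  assume norm: "MIS_normal I Gs"
  let ?K = "direct_prod I Gs" and ?V = "\<lambda>i. verts (Gs i)"
  define r where "r = ind_ratio ?K"
  have vtK: "vt_graph ?K"
    using direct_prod_vt_ratio[of I Gs] fin vt p by blast
  note vtp = vt[OF p] and vtq = vt[OF q(1)]
  note simplep = vt_graph_simple[OF vtp]
  define N where "N = closed_nbhd (Gs p) A"
  have A': "independent (Gs p) A" "A \<noteq> {}" "card A < alpha (Gs p)" "real (card A) = r * real (card N)"
    using A unfolding imprimitive_iff[OF vtp] r_def N_def rp by auto
  obtain T where T: "max_independent (Gs q) T"
    using ex_max_independent[OF vt_graph_simple[OF vtq]] by blast
  have AV: "A \<subseteq> ?V p" and TV: "T \<subseteq> ?V q"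
    using A'(1) T by (auto simp: max_independent_def independent_def)
  have NV: "N \<subseteq> ?V p" and AN: "A \<subseteq> N"
    unfolding N_def using closed_nbhd_subset[OF simplep AV] by (auto simp: closed_nbhd_def)
  define C where "C = ?V p - N"
  define S1 where "S1 = {x \<in> PiE I ?V. \<forall>i\<in>{p}. x i \<in> A}"
  define S2 where "S2 = {x \<in> PiE I ?V. \<forall>i\<in>{p, q}. x i \<in> (if i = p then C else T)}"
  have V: "finite (?V i) \<and> ?V i \<noteq> {}" if "i \<in> I" for i
    using vt[OF that] vt_graph_finite by (auto simp: vt_graph_def)
  have r0: "r > 0"
    unfolding r_def by (rule ind_ratio_pos[OF vtK])
  have pos: "real (card (?V p)) > 0" "real (card (?V q)) > 0"
    using vt_graph_card_pos vtp vtq by simp_all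
  have c1: "real (card S1) = real (card (PiE I ?V)) * (real (card A) / real (card (?V p)))"
    unfolding S1_def using card_cylinder[where I = I and V = ?V and J = "{p}" and B = "\<lambda>_. A"] fin V p AV by simp
  have "real (card S2) = real (card (PiE I ?V)) * (\<Prod>i\<in>{p, q}. real (card (if i = p then C else T)) / real (card (?V i)))"
    unfolding S2_def by (rule card_cylinder[OF fin _ V]) (use p q TV C_def in auto)
  then have c2: "real (card S2) = real (card (PiE I ?V)) * (real (card C) / real (card (?V p)) * (real (card T) / real (card (?V q))))"
    using q by simp
  have cC: "real (card C) = real (card (?V p)) - real (card N)"
    unfolding C_def using NV V[OF p] by (simp add: card_Diff_subset finite_subset card_mono of_nat_diff)
  have cT: "real (card T) / real (card (?V q)) = r"
    using pos(2) T real_alpha[OF vtq] rq by (simp add: max_independent_def r_def)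
  \<comment> \<open>As |A| = r |N| and T has density r, the set has density r times that of N plus r
    times that of its complement \<open>C\<close>, which is r.\<close>
  have "real (card S1) + real (card S2) =
      r * real (card (PiE I ?V)) * ((real (card N) + real (card C)) / real (card (?V p)))"
    unfolding c1 c2 A'(4) cT by (simp add: algebra_simps add_divide_distrib)
  then have "real (card S1) + real (card S2) = r * real (card (PiE I ?V))"
    unfolding cC using pos by simp
  moreover have "S1 \<inter> S2 = {}"
    unfolding S1_def S2_def C_def using AN by auto
  moreover have "finite S1" "finite S2"
    unfolding S1_def S2_def using finite_PiE[OF fin, of ?V] V by auto
  ultimately have cS: "real (card (S1 \<union> S2)) = ind_ratio ?K * real (card (verts ?K))"
    by (simp add: card_Un_disjoint r_def)
  have mem: "x \<in> S1 \<union> S2 \<longleftrightarrow> x \<in> PiE I ?V \<and> (x p \<in> A \<or> x p \<in> C \<and> x q \<in> T)" for x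
    unfolding S1_def S2_def using q by auto
  have "independent ?K (S1 \<union> S2)"
    unfolding independent_def
  proof (intro conjI ballI notI)
    show "S1 \<union> S2 \<subseteq> verts ?K"
      unfolding S1_def S2_def by auto
    fix x y assume x: "x \<in> S1 \<union> S2" and y: "y \<in> S1 \<union> S2" and "adj ?K x y"
    then have xy: "adj (Gs p) (x p) (y p)" "adj (Gs q) (x q) (y q)"
      using p q by (auto simp: adj_direct_prod)
    have "\<not> (x p \<in> A \<and> y p \<in> A)" "\<not> (x q \<in> T \<and> y q \<in> T)"
      using xy A'(1) T by (auto simp: independent_def max_independent_def)
    moreover have "\<not> (x p \<in> A \<and> y p \<in> C)" "\<not> (y p \<in> A \<and> x p \<in> C)"
      using xy(1) adj_sym[OF simplep xy(1)] unfolding C_def N_def closed_nbhd_def nbhd_def by auto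
    ultimately show False
      using x y unfolding mem by blast
  qed
  then have "max_independent ?K (S1 \<union> S2)"
    using max_independent_if_ratio[OF vtK _ cS] by blast
  then obtain k B where k: "k \<in> I" and B: "independent (Gs k) B" and eq: "S1 \<union> S2 = {x \<in> verts ?K. x k \<in> B}"
    using norm unfolding MIS_normal_def by blast
  have iff: "x p \<in> A \<or> x p \<in> C \<and> x q \<in> T \<longleftrightarrow> x k \<in> B" if "x \<in> PiE I ?V" for x
    using eq mem[of x] that by auto
  obtain w where w: "w \<in> PiE I ?V"
    using vtK by (auto simp: vt_graph_def)
  obtain a where a: "a \<in> A"
    using A'(2) by blast
  show False
  proof (cases "k = p")
    case False
    \<comment> \<open>With x_p = a in A the point belongs to the set whatever x_k is, even for a
      value \<open>b\<close> outside \<open>B\<close>.\<close>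
    obtain b where b: "b \<in> ?V k" "b \<notin> B"
      using independent_proper[OF vt[OF k] less[OF k] B] by blast
    have "w(p := a, k := b) \<in> PiE I ?V"
      using w p k a b AV by (intro fun_upd_PiE) auto
    from iff[OF this] show False
      using False a b by simp
  next
    case True
    \<comment> \<open>If N[A] were everything, A would have \<open>alpha (Gs p)\<close> elements. So
      \<open>C\<close> is nonempty, and for x_p in \<open>C\<close> membership depends on
      x_q.\<close>
    have "card N \<noteq> card (?V p)"
    proof
      assume "card N = card (?V p)"
      then have "real (card A) = real (alpha (Gs p))"
        using A'(4) real_alpha[OF vtp] rp by (simp add: r_def)
      then show False
        using A'(3) by simp
    qed
    then have "N \<noteq> ?V p"
      by blast
    then obtain c where c: "c \<in> C"
      using NV unfolding C_def by blast
    then have cA: "c \<in> ?V p" "c \<notin> A"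
      unfolding C_def using AN by auto
    have "card T > 0"
      using T alpha_pos[OF vtq] by (simp add: max_independent_def)
    then have "T \<noteq> {}"
      by auto
    then obtain t where t: "t \<in> T"
      by blast
    obtain t' where t': "t' \<in> ?V q" "t' \<notin> T"
      using independent_proper[OF vtq less[OF q(1)]] T by (auto simp: max_independent_def)
    have "w(p := c, q := t) \<in> PiE I ?V" "w(p := c, q := t') \<in> PiE I ?V"
      using w p q cA t t' TV by (auto intro!: fun_upd_PiE)
    from this[THEN iff] show False
      using True q(2) c cA t t' by simp
  qed
qed

text \<open>Three bipartite factors: by pigeonhole, the majority of three independent sets of half size is
  independent.\<close>

lemma not_MIS_normal_majority:
  assumes fin: "finite I" and vt: "\<And>i. i \<in> I \<Longrightarrow> vt_graph (Gs i)" and less: "\<And>i. i \<in> I \<Longrightarrow> ind_ratio (Gs i) < 1"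
    and I: "p \<in> I" "q \<in> I" "s \<in> I" and ne: "p \<noteq> q" "p \<noteq> s" "q \<noteq> s"
    and half: "ind_ratio (Gs p) = 1/2" "ind_ratio (Gs q) = 1/2" "ind_ratio (Gs s) = 1/2" "ind_ratio (direct_prod I Gs) = 1/2"
  shows "\<not> MIS_normal I Gs"
proof
  assume norm: "MIS_normal I Gs"
  let ?K = "direct_prod I Gs" and ?V = "\<lambda>i. verts (Gs i)"
  have vtK: "vt_graph ?K"
    using direct_prod_vt_ratio[of I Gs] fin vt I by blast
  have "\<forall>i\<in>I. \<exists>A. max_independent (Gs i) A"
    using ex_max_independent vt_graph_simple vt by blast
  then obtain T where T: "\<And>i. i \<in> I \<Longrightarrow> max_independent (Gs i) (T i)"
    by metis
  have V: "finite (?V i) \<and> ?V i \<noteq> {}" if "i \<in> I" for i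
    using vt[OF that] vt_graph_finite by (auto simp: vt_graph_def)
  have TV: "T i \<subseteq> ?V i" if "i \<in> I" for i
    using T[OF that] by (simp add: max_independent_def independent_def)
  define m where "m x = (x p \<in> T p \<and> x q \<in> T q \<or> x p \<in> T p \<and> x s \<in> T s \<or> x q \<in> T q \<and> x s \<in> T s)" for x
  define S where "S = {x \<in> PiE I ?V. m x}"
  \<comment> \<open>The majority set is split for counting: p and q (density 1/4), p and s without q
    (1/8), q and s without p (1/8), in total 1/2.\<close>
  define S1 where "S1 = {x \<in> PiE I ?V. \<forall>i\<in>{p, q}. x i \<in> T i}"
  define S2 where "S2 = {x \<in> PiE I ?V. \<forall>i\<in>{p, q, s}. x i \<in> (if i = q then ?V q - T q else T i)}"
  define S3 where "S3 = {x \<in> PiE I ?V. \<forall>i\<in>{p, q, s}. x i \<in> (if i = p then ?V p - T p else T i)}"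
  have hT: "real (card (T i)) / real (card (?V i)) = 1/2"
    and hC: "real (card (?V i - T i)) / real (card (?V i)) = 1/2" if "i \<in> {p, q, s}" for i
  proof -
    have i: "i \<in> I" "ind_ratio (Gs i) = 1/2"
      using that I half by auto
    have "real (card (T i)) = 1/2 * real (card (?V i))"
      using T[OF i(1)] real_alpha[OF vt[OF i(1)]] i(2) by (simp add: max_independent_def)
    moreover have "real (card (?V i - T i)) = real (card (?V i)) - real (card (T i))"
      using TV[OF i(1)] V[OF i(1)] by (simp add: card_Diff_subset finite_subset card_mono of_nat_diff)
    moreover have "real (card (?V i)) > 0"
      using vt_graph_card_pos[OF vt[OF i(1)]] by simp
    ultimately show "real (card (T i)) / real (card (?V i)) = 1/2"
      "real (card (?V i - T i)) / real (card (?V i)) = 1/2"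
      by (simp_all add: field_simps)
  qed
  have "real (card S1) = real (card (PiE I ?V)) * (\<Prod>i\<in>{p, q}. real (card (T i)) / real (card (?V i)))"
    unfolding S1_def by (rule card_cylinder[OF fin _ V]) (use I TV in auto)
  then have c1: "real (card S1) = real (card (PiE I ?V)) * (1/4)"
    using hT ne by simp
  have "real (card S2) = real (card (PiE I ?V)) *
      (\<Prod>i\<in>{p, q, s}. real (card (if i = q then ?V q - T q else T i)) / real (card (?V i)))"
    unfolding S2_def by (rule card_cylinder[OF fin _ V]) (use I TV in auto)
  then have c2: "real (card S2) = real (card (PiE I ?V)) * (1/8)"
    using hT hC ne by simp
  have "real (card S3) = real (card (PiE I ?V)) *
      (\<Prod>i\<in>{p, q, s}. real (card (if i = p then ?V p - T p else T i)) / real (card (?V i)))"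
    unfolding S3_def by (rule card_cylinder[OF fin _ V]) (use I TV in auto)
  then have c3: "real (card S3) = real (card (PiE I ?V)) * (1/8)"
    using hT hC ne by simp
  have fins: "finite S1" "finite S2" "finite S3"
    unfolding S1_def S2_def S3_def using finite_PiE[OF fin, of ?V] V by auto
  have disj: "S1 \<inter> S2 = {}" "(S1 \<union> S2) \<inter> S3 = {}"
    unfolding S1_def S2_def S3_def using ne by auto
  have "S = S1 \<union> S2 \<union> S3"
  proof (rule set_eqI)
    fix x
    have "x p \<in> ?V p" "x q \<in> ?V q" if "x \<in> PiE I ?V"
      using that I by (auto simp: PiE_iff)
    then show "x \<in> S \<longleftrightarrow> x \<in> S1 \<union> S2 \<union> S3"
      unfolding S_def S1_def S2_def S3_def m_def using ne by auto
  qed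
  then have "card S = card S1 + card S2 + card S3"
    using fins disj by (simp add: card_Un_disjoint)
  then have cS: "real (card S) = ind_ratio ?K * real (card (verts ?K))"
    unfolding half(4) using c1 c2 c3 by simp
  have "independent ?K S"
    unfolding independent_def
  proof (intro conjI ballI notI)
    show "S \<subseteq> verts ?K"
      unfolding S_def by auto
    fix x y assume x: "x \<in> S" and y: "y \<in> S" and xy: "adj ?K x y"
    have "\<not> (x i \<in> T i \<and> y i \<in> T i)" if "i \<in> I" for i
      using T[OF that] xy that by (auto simp: adj_direct_prod independent_def max_independent_def)
    from this[OF I(1)] this[OF I(2)] this[OF I(3)] show False
      using x y unfolding S_def m_def by blast
  qed
  then have "max_independent ?K S"
    using max_independent_if_ratio[OF vtK _ cS] by blast
  then obtain k B where k: "k \<in> I" and B: "independent (Gs k) B" and eq: "S = {x \<in> verts ?K. x k \<in> B}"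
    using norm unfolding MIS_normal_def by blast
  obtain w where w: "w \<in> PiE I ?V"
    using vtK by (auto simp: vt_graph_def)
  obtain b where b: "b \<in> ?V k" "b \<notin> B"
    using independent_proper[OF vt[OF k] less[OF k] B] by blast
  have ex: "\<exists>t. t \<in> T i" if "i \<in> I" for i
  proof -
    have "card (T i) > 0"
      using T[OF that] alpha_pos[OF vt[OF that]] by (simp add: max_independent_def)
    then have "T i \<noteq> {}"
      by auto
    then show ?thesis
      by blast
  qed
  obtain tp tq ts where t: "tp \<in> T p" "tq \<in> T q" "ts \<in> T s"
    using ex[OF I(1)] ex[OF I(2)] ex[OF I(3)] by blast
  \<comment> \<open>\<open>k\<close> is overwritten last and may be one of p, q, s; the other two
    still form a majority, so membership cannot force x_k into \<open>B\<close>.\<close>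
  define x where "x = w(p := tp, q := tq, s := ts, k := b)"
  have "x \<in> PiE I ?V"
    unfolding x_def using w I k b t TV by (intro fun_upd_PiE) auto
  moreover have "m x"
    unfolding m_def x_def using t ne by auto
  ultimately have "x \<in> S"
    by (simp add: S_def)
  then have "x k \<in> B"
    unfolding eq by simp
  then show False
    using b by (simp add: x_def)
qed

theorem theorem3p4:
  fixes n l :: nat and Gs :: "nat \<Rightarrow> 'a sgraph"
  assumes "n \<ge> 2" and "1 \<le> l" and "l \<le> n"
    and "\<forall>i\<in>{1..n}. simple_graph (Gs i) \<and> connected_graph (Gs i) \<and> vertex_transitive (Gs i)"
    and "ind_ratio (Gs 1) \<le> 1/2"
    and "\<forall>i\<in>{1..l}. ind_ratio (Gs i) = ind_ratio (Gs 1)"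
    and "l < n \<longrightarrow> ind_ratio (Gs (Suc l)) < ind_ratio (Gs l)"
    and "\<forall>i. Suc l \<le> i \<and> i < n \<longrightarrow> ind_ratio (Gs (Suc i)) \<le> ind_ratio (Gs i)"
  shows "MIS_normal {1..n} Gs \<longleftrightarrow>
    ((ind_ratio (Gs 1) < 1/2 \<and> (l > 1 \<longrightarrow> (\<forall>i\<in>{1..l}. IS_primitive (Gs i))))
     \<or> (ind_ratio (Gs 1) = 1/2 \<and> l \<le> 2))"
proof -
  note n = assms(1) and l = assms(2,3)
  let ?r = "ind_ratio (Gs 1)"
  have simple: "simple_graph (Gs i)" and con: "connected_graph (Gs i)" and vt: "vt_graph (Gs i)"
    if "i \<in> {1..n}" for i
    using assms(4) that by (auto simp: vt_graph_def connected_graph_def)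
  have rl: "ind_ratio (Gs i) = ?r" if "i \<in> {1..l}" for i
    using assms(6) that by blast
  have rless: "ind_ratio (Gs i) < ?r" if "Suc l \<le> i" "i \<le> n" for i
    using that
  proof (induction i rule: dec_induct)
    case base
    then show ?case
      using assms(7) rl[of l] l by simp
  next
    case (step i)
    then have "ind_ratio (Gs (Suc i)) \<le> ind_ratio (Gs i)" "ind_ratio (Gs i) < ?r"
      using assms(8) by auto
    then show ?case
      by simp
  qed
  have rle: "ind_ratio (Gs i) \<le> ?r" if "i \<in> {1..n}" for i
    using rl[of i] rless[of i] that by (cases "i \<le> l") auto
  have less1: "ind_ratio (Gs i) < 1" if "i \<in> {1..n}" for i
    using rle[OF that] assms(5) by simp
  have prod: "vt_graph (direct_prod {1..m} Gs)" "ind_ratio (direct_prod {1..m} Gs) = ?r"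
    if "1 \<le> m" "m \<le> n" for m
  proof -
    have "vt_graph (direct_prod {1..m} Gs) \<and>
        ind_ratio (direct_prod {1..m} Gs) = Max ((\<lambda>i. ind_ratio (Gs i)) ` {1..m})"
      using that vt by (intro direct_prod_vt_ratio) auto
    moreover have "Max ((\<lambda>i. ind_ratio (Gs i)) ` {1..m}) = ?r"
      using that rle by (intro Max_eqI) auto
    ultimately show "vt_graph (direct_prod {1..m} Gs)" "ind_ratio (direct_prod {1..m} Gs) = ?r"
      by auto
  qed
  have insert_Suc: "{1..Suc m} = insert (Suc m) {1..m}" for m
    by auto
  \<comment> \<open>Each factor beyond \<open>l\<close> has smaller ratio than the product so far,
    whose ratio remains that of the first factor; so \<open>tensor_normal_greater\<close> applies
    each time.\<close>
  have extend: "MIS_normal {1..n} Gs" if "MIS_normal {1..l} Gs"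
    using l(2)
  proof (induction n rule: dec_induct)
    case base
    then show ?case
      using that .
  next
    case (step m)
    then have m: "1 \<le> m" "m \<le> n" "Suc m \<in> {1..n}" "Suc l \<le> Suc m" "Suc m \<le> n"
      using l by auto
    note K = prod[OF m(1,2)]
    have "ind_ratio (Gs (Suc m)) < ind_ratio (direct_prod {1..m} Gs)"
      using rless[OF m(4,5)] K(2) by simp
    then show ?case
      unfolding insert_Suc
      using MIS_normal_insert[OF _ K(1) vt[OF m(3)] _ step.IH]
        tensor_normal_greater[OF K(1) vt[OF m(3)] con[OF m(3)] _ less1[OF m(3)]] by force
  qed
  show ?thesis
  proof
    assume norm: "MIS_normal {1..n} Gs"
    have ratio: "ind_ratio (direct_prod {1..n} Gs) = ?r"
      using prod n by simp
    have "l \<le> 2" if "?r = 1/2"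
    proof (rule ccontr)
      assume "\<not> l \<le> 2"
      then have "2 \<in> {1..l}" "3 \<in> {1..l}"
        by auto
      then have half: "ind_ratio (Gs 2) = 1/2" "ind_ratio (Gs 3) = 1/2"
        using rl[of 2] rl[of 3] that by simp_all
      have "\<not> MIS_normal {1..n} Gs"
        by (rule not_MIS_normal_majority[OF _ vt less1, where p = 1 and q = 2 and s = 3])
          (use \<open>\<not> l \<le> 2\<close> l half that ratio in auto)
      then show False
        using norm by simp
    qed
    \<comment> \<open>For \<open>l > 1\<close> there is a second factor \<open>j\<close> of maximal
      ratio, as the construction from an imprimitive set requires.\<close>
    moreover have "IS_primitive (Gs i)" if "l > 1" "i \<in> {1..l}" for i
    proof (rule ccontr)
      assume "\<not> IS_primitive (Gs i)"
      then obtain A where A: "imprimitive (Gs i) A"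
        unfolding IS_primitive_def by blast
      obtain j where j: "j \<in> {1..l}" "i \<noteq> j"
      proof (cases "i = 1")
        case True
        then show ?thesis
          using \<open>l > 1\<close> that[of 2] by simp
      next
        case False
        then show ?thesis
          using \<open>l > 1\<close> that[of 1] by simp
      qed
      have "\<not> MIS_normal {1..n} Gs"
        by (rule not_MIS_normal_imprimitive[where I = "{1..n}" and Gs = Gs and p = i and q = j, OF _ vt less1 _ _ j(2) _ _ A])
          (use \<open>i \<in> {1..l}\<close> j(1) l rl[of i] rl[of j] ratio in simp_all)
      then show False
        using norm by simp
    qed
    ultimately show "(?r < 1/2 \<and> (l > 1 \<longrightarrow> (\<forall>i\<in>{1..l}. IS_primitive (Gs i)))) \<or> (?r = 1/2 \<and> l \<le> 2)"
      using assms(5) by (cases "?r = 1/2") auto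
  next
    assume cond: "(?r < 1/2 \<and> (l > 1 \<longrightarrow> (\<forall>i\<in>{1..l}. IS_primitive (Gs i)))) \<or> (?r = 1/2 \<and> l \<le> 2)"
    have "MIS_normal {1..l} Gs"
    proof (cases "l = 1")
      case True
      then show ?thesis
        using MIS_normal_singleton[of 1 Gs] by simp
    next
      case False
      then have l1: "l > 1"
        using l by simp
      show ?thesis
      proof (cases "?r = 1/2")
        case True
        then have l2: "l = 2"
          using cond l1 by auto
        then have in_n: "(1::nat) \<in> {1..n}" "(2::nat) \<in> {1..n}" and r2: "ind_ratio (Gs 2) = 1/2"
          using l rl[of 2] True by auto
        \<comment> \<open>With two bipartite factors a single binary step suffices: the product over
          {1} is a copy of the first factor, hence connected, and \<open>IS_primitive_half\<close>
          supplies primitivity on both sides.\<close>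
        note K = prod[of 1, OF order_refl]
        have vtK: "vt_graph (direct_prod {1} Gs)" and rK: "ind_ratio (direct_prod {1} Gs) = 1/2"
          using K n True by auto
        have conK: "connected_graph (direct_prod {1} Gs)"
          by (rule graph_iso_connected[OF graph_iso_inv[OF graph_iso_singleton[of 1 Gs]] simple[OF in_n(1)] con[OF in_n(1)]])
        have "MIS_normal (insert 2 {1}) Gs"
        proof (rule MIS_normal_insert[OF _ vtK vt[OF in_n(2)] _ MIS_normal_singleton])
          fix S assume "max_independent (tensor (direct_prod {1} Gs) (Gs 2)) S"
          then show "(\<exists>J. independent (direct_prod {1} Gs) J \<and> S = J \<times> verts (Gs 2)) \<or>
              (\<exists>J. independent (Gs 2) J \<and> S = verts (direct_prod {1} Gs) \<times> J)"
            by (intro tensor_normal_primitive[OF vtK vt[OF in_n(2)] conK con[OF in_n(2)]]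
                IS_primitive_half vtK conK vt in_n con) (use rK r2 in auto)
        qed (use rK r2 in auto)
        moreover have "{1..l} = insert 2 {1}"
          using l2 by auto
        ultimately show ?thesis
          by simp
      next
        case False
        then have less: "?r < 1/2" and prim: "IS_primitive (Gs i)" if "i \<in> {1..l}" for i
          using cond l1 that by auto
        have in_n: "i \<in> {1..n}" if "i \<in> {1..l}" for i
          using that l by simp
        have "even_connected (direct_prod {1..l} Gs) \<and> IS_primitive (direct_prod {1..l} Gs) \<and>
            MIS_normal {1..l} Gs"
        proof (rule direct_prod_primitive[where r = ?r])
          show "{1..l} \<noteq> {}" and "?r < 1/2"
            using l less[of 1] by simp_all
        qed (simp, rule vt[OF in_n], simp, rule con[OF in_n], simp, rule prim, simp, rule rl, simp)
        then show ?thesis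
          by blast
      qed
    qed
    then show "MIS_normal {1..n} Gs"
      by (rule extend)
  qed
qed

end
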